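(* Let $(a_{nk})_{n,k=0}^\infty$ be an infinite complex matrix satisfying the following conditions. (E1) There exist $(d_n)_{n\in\mathbb{N}_0}\subset(0,\infty)$ and $(b_{nk})_{n,k\in\mathbb{N}_0},(c_{nk})_{n,k\in\mathbb{N}_0}\subset\mathbb{C}$ such that $a_{nk}=-\delta_{nk}d_n+b_{nk}+c_{nk}$ for $n,k\in\mathbb{N}_0$, where $\delta_{nk}$ is the Kronecker delta. (E2) There exist $\alpha_*\in\mathbb{R}$ and, for all $\alpha>\alpha_*$, a constant $q(\alpha)\in(0,1)$ with $e^{-\alpha k}\sum_{n=0}^\infty|b_{nk}|e^{\alpha n}\le q(\alpha)d_k$ for all $k\in\mathbb{N}_0$, $\alpha>\alpha_*$. (E3) $\sup_{n\in\mathbb{N}}d_ne^{-\nu n}<\infty$ for all $\nu>0$. (E4) There exists a continuous increasing function $M:(\alpha_*,\infty)\to(0,\infty)$ such that $e^{-\alpha k}\sum_{n=0}^\infty|c_{nk}|e^{\alpha'n}\le\frac{M(\alpha)}{\alpha-\alpha'}$ for all $k\in\mathbb{N}_0$ and $\alpha_*<\alpha'<\alpha$. Then, for all $\alpha_*<\alpha'<\alpha$ and $x=(x_n)_{n=0}^\infty\in\mathbb{E}_\alpha$, there exists a unique classical solution $(u(t))_{t\in[0,T(\alpha',\alpha))}$ in $\mathbb{E}_{\alpha'}$, with $T(\alpha',\alpha)=\frac{\alpha-\alpha'}{2eM(\alpha)}$, to $$\frac{du_n(t)}{dt}=\sum_{k=0}^\infty a_{nk}u_k(t),\qquad u_n(0)=x_n,\qquad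 n\in\mathbb{N}_0.$$
   Context: For $\alpha\in\mathbb{R}$, $\mathbb{E}_\alpha$ is the Banach space of complex sequences $u=(u_n)_{n=0}^\infty$ with $\|u\|_\alpha:=\sum_{n=0}^\infty|u_n|e^{\alpha n}<\infty$; $\mathbb{E}_\alpha\subset\mathbb{E}_{\alpha'}$ for $\alpha'<\alpha$, with embedding denoted $i_{\alpha\alpha'}$. Under (E1)–(E4) the map $(Gu)_n:=\sum_ka_{nk}u_k$ is (with absolutely convergent sums) a bounded linear operator from $\mathbb{E}_{\beta}$ to $\mathbb{E}_{\beta'}$ for all $\alpha_*<\beta'<\beta$. Classical solution in $\mathbb{E}_{\alpha'}$ on an interval $I=[0,T)$ (for $x\in\mathbb{E}_\alpha$, $\alpha_*<\alpha'<\alpha$): a function $u\in C(I;\mathbb{E}_{\alpha'})$ with $u(0)=x$ such that, for all $\alpha''\in(\alpha_*,\alpha')$, $i_{\alpha'\alpha''}u\in C^1(I;\mathbb{E}_{\alpha''})$ and $\frac{d}{dt}i_{\alpha'\alpha''}u(t)=Gu(t)$ in $\mathbb{E}_{\alpha''}$ for $t\in I$. *)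

theory Defs
  imports "HOL-Analysis.Analysis"
begin

definition E_space :: "real \<Rightarrow> (nat \<Rightarrow> complex) set" where
  "E_space \<alpha> = {u. summable (\<lambda>n. cmod (u n) * exp (\<alpha> * real n))}"

definition E_norm :: "real \<Rightarrow> (nat \<Rightarrow> complex) \<Rightarrow> real" where
  "E_norm \<alpha> u = (\<Sum>n. cmod (u n) * exp (\<alpha> * real n))"

text \<open>The spaces are indexed by a real number and all consist of functions of one type, so they
  are sets rather than types, and the embeddings between them are inclusions. Continuity and
  differentiability of curves therefore carry the index \<open>\<alpha>\<close> of the norm that is used.\<close>

definition E_continuous_on :: "real \<Rightarrow> real set \<Rightarrow> (real \<Rightarrow> nat \<Rightarrow> complex) \<Rightarrow> bool" where
  "E_continuous_on \<alpha> I u \<longleftrightarrow>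
     (\<forall>t\<in>I. u t \<in> E_space \<alpha>) \<and>
     (\<forall>t\<in>I. ((\<lambda>s. E_norm \<alpha> (\<lambda>n. u s n - u t n)) \<longlongrightarrow> 0) (at t within I))"

text \<open>At the left endpoint of \<open>I = [0,T)\<close> this is the one-sided derivative.\<close>

definition has_E_derivative ::
  "real \<Rightarrow> real set \<Rightarrow> (real \<Rightarrow> nat \<Rightarrow> complex) \<Rightarrow> (nat \<Rightarrow> complex) \<Rightarrow> real \<Rightarrow> bool" where
  "has_E_derivative \<alpha> I u v t \<longleftrightarrow>
     (\<forall>s\<in>I. u s \<in> E_space \<alpha>) \<and> v \<in> E_space \<alpha> \<and>
     ((\<lambda>s. E_norm \<alpha> (\<lambda>n. (u s n - u t n) / of_real (s - t) - v n)) \<longlongrightarrow> 0) (at t within I)"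

definition E_C1_on :: "real \<Rightarrow> real set \<Rightarrow> (real \<Rightarrow> nat \<Rightarrow> complex) \<Rightarrow> bool" where
  "E_C1_on \<alpha> I u \<longleftrightarrow>
     (\<exists>v. E_continuous_on \<alpha> I v \<and> (\<forall>t\<in>I. has_E_derivative \<alpha> I u (v t) t))"

definition matrix_op :: "(nat \<Rightarrow> nat \<Rightarrow> complex) \<Rightarrow> (nat \<Rightarrow> complex) \<Rightarrow> nat \<Rightarrow> complex" where
  "matrix_op a u n = (\<Sum>k. a n k * u k)"

definition classical_solution ::
  "real \<Rightarrow> (nat \<Rightarrow> nat \<Rightarrow> complex) \<Rightarrow> real \<Rightarrow> real \<Rightarrow> (nat \<Rightarrow> complex)
    \<Rightarrow> (real \<Rightarrow> nat \<Rightarrow> complex) \<Rightarrow> bool" where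
  "classical_solution \<alpha>star a \<alpha>' T x u \<longleftrightarrow>
     E_continuous_on \<alpha>' {0..<T} u \<and> u 0 = x \<and>
     (\<forall>\<alpha>''\<in>{\<alpha>star<..<\<alpha>'}.
        E_C1_on \<alpha>'' {0..<T} u \<and>
        (\<forall>t\<in>{0..<T}. has_E_derivative \<alpha>'' {0..<T} u (matrix_op a (u t)) t))"

end

theory Submission
  imports Defs
begin

text \<open>
  Write \<open>G = - D + B + C\<close> for the diagonal, the matrix \<open>b\<close> and the matrix \<open>c\<close>. In the weighted
  \<open>\<ell>\<^sup>1\<close> norms a column condition on a matrix is the same as an operator bound. The condition on \<open>b\<close>
  says that \<open>\<parallel>B u\<parallel>\<close> is at most \<open>\<parallel>D u\<parallel>\<close> in every norm of the scale, so the damping \<open>- D\<close>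
  absorbs \<open>B\<close>. This is seen without constructing a semigroup: for \<open>w' = - D w + f\<close> the backward
  difference \<open>w - h w' = (1 + h D) w - h f\<close> is, up to \<open>o(h)\<close>, the earlier value of \<open>w\<close>, and
  comparing norms bounds the left derivative of \<open>\<parallel>w\<parallel>\<close> by \<open>\<parallel>f\<parallel> - \<parallel>D w\<parallel>\<close>
  (\<open>dissipative_left_derivative\<close>). Hence along a solution of \<open>w' = G w + g\<close> only \<open>C w\<close> and \<open>g\<close> can
  make the norm grow.

  The operator \<open>C\<close> costs a factor \<open>M / h\<close> for a loss \<open>h\<close> of weight, as in the theorem of
  Ovsyannikov. If \<open>\<parallel>w(t)\<parallel>\<close> with weight index \<open>\<beta>\<close> is at most \<open>N (\<alpha> - \<beta>) / (\<alpha> - \<beta> - \<mu> t)\<close> on the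
  triangle \<open>\<mu> t < \<alpha> - \<beta>\<close>, then taking for \<open>h\<close> half of the remaining room \<open>\<alpha> - \<beta> - \<mu> t\<close> at each
  time and integrating gives a bound of the same form, with \<open>N\<close> replaced by \<open>4 M(\<alpha>) / \<mu> \<cdot> N\<close> plus
  the contributions of the initial value and of \<open>g\<close>. For \<open>\<mu> = 2 e M(\<alpha>)\<close> the factor is \<open>2 / e < 1\<close>, so
  that iteration removes \<open>N\<close> altogether. The outcome, \<open>a_priori_bound\<close>, has the lifetime
  \<open>(\<alpha> - \<alpha>') / \<mu>\<close> of the theorem built in, and the rest of the proof applies it three times.

  \<^item> To the solutions of the finite systems obtained by restricting \<open>b\<close> and \<open>c\<close> to indices below
    \<open>N\<close>: they are bounded uniformly in \<open>N\<close>.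
  \<^item> To the difference of two such solutions, started from an index slightly below \<open>\<alpha>\<close>. The
    difference of two restrictions of \<open>G\<close> is exponentially small in \<open>N\<close> after a small loss of weight,
    so the finite solutions are uniformly Cauchy (\<open>truncated_solutions_Cauchy\<close>).
  \<^item> To the difference of two classical solutions, on successive short time intervals; with zero
    data the bound is zero (\<open>solution_unique\<close>).

  The limit of the finite solutions satisfies the system coordinate by coordinate. Since \<open>G u\<close> is
  continuous into every space with smaller weight, the mean value inequality upgrades this to
  differentiability in norm (\<open>has_E_derivative_coordinatewise\<close>).
\<close>

section \<open>Weighted spaces\<close>

lemma E_spaceD: "u \<in> E_space \<alpha> \<Longrightarrow> summable (\<lambda>n. cmod (u n) * exp (\<alpha> * real n))"
  by (simp add: E_space_def)

text \<open>Membership in the space and a bound for the norm both come from a bound for all partial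
  sums; this keeps infinite sums out of most estimates.\<close>

lemma E_norm_leI:
  assumes "\<And>m. (\<Sum>n<m. cmod (u n) * exp (\<alpha> * real n)) \<le> K"
  shows "u \<in> E_space \<alpha>" and "E_norm \<alpha> u \<le> K"
proof -
  have s: "summable (\<lambda>n. cmod (u n) * exp (\<alpha> * real n))"
    by (rule summableI_nonneg_bounded[where x=K]) (use assms in auto)
  then show "u \<in> E_space \<alpha>" by (simp add: E_space_def)
  show "E_norm \<alpha> u \<le> K"
    unfolding E_norm_def by (rule suminf_le_const[OF s assms])
qed

lemma E_norm_nonneg: "u \<in> E_space \<alpha> \<Longrightarrow> 0 \<le> E_norm \<alpha> u"
  unfolding E_norm_def by (intro suminf_nonneg E_spaceD) auto

lemma partial_sum_le_E_norm:
  "u \<in> E_space \<alpha> \<Longrightarrow> (\<Sum>n<m. cmod (u n) * exp (\<alpha> * real n)) \<le> E_norm \<alpha> u"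
  unfolding E_norm_def by (intro sum_le_suminf E_spaceD) auto

lemma coordinate_le_E_norm:
  assumes "u \<in> E_space \<alpha>"
  shows "cmod (u n) * exp (\<alpha> * real n) \<le> E_norm \<alpha> u"
proof -
  have "(\<Sum>i\<in>{n}. cmod (u i) * exp (\<alpha> * real i)) \<le> E_norm \<alpha> u"
    unfolding E_norm_def by (intro sum_le_suminf E_spaceD assms) auto
  then show ?thesis by simp
qed

lemma E_norm_dominated:
  assumes v: "v \<in> E_space \<beta>"
    and le: "\<And>n. cmod (u n) * exp (\<alpha> * real n) \<le> r * (cmod (v n) * exp (\<beta> * real n))"
    and r: "0 \<le> r"
  shows "u \<in> E_space \<alpha>" and "E_norm \<alpha> u \<le> r * E_norm \<beta> v"
proof -
  have *: "(\<Sum>n<m. cmod (u n) * exp (\<alpha> * real n)) \<le> r * E_norm \<beta> v" for m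
  proof -
    have "(\<Sum>n<m. cmod (u n) * exp (\<alpha> * real n))
        \<le> (\<Sum>n<m. r * (cmod (v n) * exp (\<beta> * real n)))"
      by (intro sum_mono le)
    also have "\<dots> \<le> r * E_norm \<beta> v"
      unfolding sum_distrib_left[symmetric]
      by (intro mult_left_mono partial_sum_le_E_norm v r)
    finally show ?thesis .
  qed
  show "u \<in> E_space \<alpha>" "E_norm \<alpha> u \<le> r * E_norm \<beta> v"
    by (rule E_norm_leI[OF *])+
qed

lemma E_space_antimono: "u \<in> E_space \<alpha> \<Longrightarrow> \<beta> \<le> \<alpha> \<Longrightarrow> u \<in> E_space \<beta>"
  by (rule E_norm_dominated(1)[where r=1 and v=u and \<beta>=\<alpha>])
    (auto intro!: mult_left_mono mult_right_mono)

lemma E_norm_mono: "u \<in> E_space \<alpha> \<Longrightarrow> \<beta> \<le> \<alpha> \<Longrightarrow> E_norm \<beta> u \<le> E_norm \<alpha> u"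
  using E_norm_dominated(2)[where r=1 and v=u and u=u and \<beta>=\<alpha> and \<alpha>=\<beta>]
  by (simp add: mult_left_mono mult_right_mono)

lemma E_norm_add:
  assumes "u \<in> E_space \<alpha>" "v \<in> E_space \<alpha>"
  shows "(\<lambda>n. u n + v n) \<in> E_space \<alpha>"
    and "E_norm \<alpha> (\<lambda>n. u n + v n) \<le> E_norm \<alpha> u + E_norm \<alpha> v"
proof -
  have *: "(\<Sum>n<m. cmod (u n + v n) * exp (\<alpha> * real n)) \<le> E_norm \<alpha> u + E_norm \<alpha> v" for m
  proof -
    have "(\<Sum>n<m. cmod (u n + v n) * exp (\<alpha> * real n))
        \<le> (\<Sum>n<m. cmod (u n) * exp (\<alpha> * real n) + cmod (v n) * exp (\<alpha> * real n))"
      unfolding distrib_right[symmetric]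
      by (intro sum_mono mult_right_mono norm_triangle_ineq) auto
    also have "\<dots> \<le> E_norm \<alpha> u + E_norm \<alpha> v"
      unfolding sum.distrib by (intro add_mono partial_sum_le_E_norm assms)
    finally show ?thesis .
  qed
  show "(\<lambda>n. u n + v n) \<in> E_space \<alpha>" "E_norm \<alpha> (\<lambda>n. u n + v n) \<le> E_norm \<alpha> u + E_norm \<alpha> v"
    by (rule E_norm_leI[OF *])+
qed

lemma E_norm_scale:
  assumes "u \<in> E_space \<alpha>"
  shows "(\<lambda>n. r * u n) \<in> E_space \<alpha>"
    and "E_norm \<alpha> (\<lambda>n. r * u n) = cmod r * E_norm \<alpha> u"
proof -
  show "(\<lambda>n. r * u n) \<in> E_space \<alpha>"
    using summable_mult[OF E_spaceD[OF assms], of "cmod r"]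
    by (simp add: E_space_def norm_mult mult.assoc)
  show "E_norm \<alpha> (\<lambda>n. r * u n) = cmod r * E_norm \<alpha> u"
    using suminf_mult[OF E_spaceD[OF assms], of "cmod r"]
    by (simp add: E_norm_def norm_mult mult.assoc)
qed

lemma E_norm_diff:
  assumes "u \<in> E_space \<alpha>" "v \<in> E_space \<alpha>"
  shows "(\<lambda>n. u n - v n) \<in> E_space \<alpha>"
    and "E_norm \<alpha> (\<lambda>n. u n - v n) \<le> E_norm \<alpha> u + E_norm \<alpha> v"
  using E_norm_add[OF assms(1) E_norm_scale(1)[OF assms(2), of "-1"]]
    E_norm_scale(2)[OF assms(2), of "-1"] by simp_all

lemma E_norm_reverse_triangle:
  assumes "u \<in> E_space \<alpha>" "v \<in> E_space \<alpha>"
  shows "\<bar>E_norm \<alpha> u - E_norm \<alpha> v\<bar> \<le> E_norm \<alpha> (\<lambda>n. u n - v n)"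
proof -
  have "E_norm \<alpha> (\<lambda>n. v n - u n) = E_norm \<alpha> (\<lambda>n. u n - v n)"
    by (simp add: E_norm_def norm_minus_commute)
  then show ?thesis
    using E_norm_add(2)[OF assms(2) E_norm_diff(1)[OF assms]]
      E_norm_add(2)[OF assms(1) E_norm_diff(1)[OF assms(2,1)]] by simp
qed

lemma E_norm_eq_0D: "u \<in> E_space \<alpha> \<Longrightarrow> E_norm \<alpha> u \<le> 0 \<Longrightarrow> u n = 0"
  using coordinate_le_E_norm[of u \<alpha> n]
  by (smt (verit) exp_gt_zero mult_pos_pos zero_less_norm_iff)

text \<open>The Schur-type test for weighted \<open>\<ell>\<^sup>1\<close>: after restricting to finitely many rows the order of
  summation may be exchanged, and each column contributes at most its own bound. Using partial sums
  over the rows avoids an exchange of two infinite sums.\<close>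

lemma matrix_op_column_bound:
  assumes col: "\<And>k m. (\<Sum>n<m. cmod (A n k) * exp (\<beta> * real n)) \<le> W k"
    and W: "summable (\<lambda>k. W k * cmod (u k))"
  shows "summable (\<lambda>k. A n k * u k)"
    and "matrix_op A u \<in> E_space \<beta>"
    and "E_norm \<beta> (matrix_op A u) \<le> (\<Sum>k. W k * cmod (u k))"
proof -
  have abs: "summable (\<lambda>k. cmod (A n k * u k) * exp (\<beta> * real n))" for n
  proof (rule summable_comparison_test'[OF W, of 0])
    fix k
    have "cmod (A n k) * exp (\<beta> * real n) \<le> (\<Sum>i<Suc n. cmod (A i k) * exp (\<beta> * real i))"
      by (simp add: sum_nonneg)
    also have "\<dots> \<le> W k" by (rule col)
    finally show "norm (cmod (A n k * u k) * exp (\<beta> * real n)) \<le> W k * cmod (u k)"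
      using mult_right_mono[of "cmod (A n k) * exp (\<beta> * real n)" "W k" "cmod (u k)"]
      by (simp add: norm_mult mult_ac)
  qed
  then have abs': "summable (\<lambda>k. cmod (A n k * u k))" for n
    using summable_mult2[OF abs, of n "exp (- (\<beta> * real n))"]
    by (simp add: mult.assoc flip: exp_add)
  then show "summable (\<lambda>k. A n k * u k)" by (rule summable_norm_cancel)
  have *: "(\<Sum>n<m. cmod (matrix_op A u n) * exp (\<beta> * real n)) \<le> (\<Sum>k. W k * cmod (u k))" for m
  proof -
    have "(\<Sum>n<m. cmod (matrix_op A u n) * exp (\<beta> * real n))
        \<le> (\<Sum>n<m. (\<Sum>k. cmod (A n k * u k)) * exp (\<beta> * real n))"
      unfolding matrix_op_def by (intro sum_mono mult_right_mono summable_norm abs') auto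
    also have "\<dots> = (\<Sum>n<m. \<Sum>k. cmod (A n k * u k) * exp (\<beta> * real n))"
      by (intro sum.cong refl suminf_mult2 abs')
    also have "\<dots> = (\<Sum>k. \<Sum>n<m. cmod (A n k * u k) * exp (\<beta> * real n))"
      by (intro suminf_sum[symmetric] abs)
    also have "\<dots> \<le> (\<Sum>k. W k * cmod (u k))"
    proof (intro suminf_le W summable_sum abs)
      fix k
      show "(\<Sum>n<m. cmod (A n k * u k) * exp (\<beta> * real n)) \<le> W k * cmod (u k)"
        using mult_right_mono[OF col[of k m], of "cmod (u k)"]
        by (simp add: norm_mult sum_distrib_left sum_distrib_right mult_ac)
    qed
    finally show ?thesis .
  qed
  show "matrix_op A u \<in> E_space \<beta>" "E_norm \<beta> (matrix_op A u) \<le> (\<Sum>k. W k * cmod (u k))"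
    by (rule E_norm_leI[OF *])+
qed

section \<open>Curves in weighted spaces\<close>

lemma has_E_derivative_continuous:
  assumes deriv: "has_E_derivative \<beta> I w v t" and t: "t \<in> I"
  shows "((\<lambda>s. E_norm \<beta> (\<lambda>n. w s n - w t n)) \<longlongrightarrow> 0) (at t within I)"
proof -
  define y where "y s n = (w s n - w t n) / of_real (s - t) - v n" for s n
  have wE: "\<And>s. s \<in> I \<Longrightarrow> w s \<in> E_space \<beta>" and vE: "v \<in> E_space \<beta>"
    and lim: "((\<lambda>s. E_norm \<beta> (y s)) \<longlongrightarrow> 0) (at t within I)"
    using deriv by (auto simp: has_E_derivative_def y_def[abs_def])
  have "((\<lambda>s. \<bar>s - t\<bar> * (E_norm \<beta> (y s) + E_norm \<beta> v)) \<longlongrightarrow> \<bar>t - t\<bar> * (0 + E_norm \<beta> v)) (at t within I)"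
    by (intro tendsto_intros lim)
  then have lim0: "((\<lambda>s. \<bar>s - t\<bar> * (E_norm \<beta> (y s) + E_norm \<beta> v)) \<longlongrightarrow> 0) (at t within I)"
    by simp
  have diffE: "(\<lambda>n. w s n - w t n) \<in> E_space \<beta>" if "s \<in> I" for s
    by (intro E_norm_diff wE that t)
  have le: "E_norm \<beta> (\<lambda>n. w s n - w t n) \<le> \<bar>s - t\<bar> * (E_norm \<beta> (y s) + E_norm \<beta> v)"
    if s: "s \<in> I" "s \<noteq> t" for s
  proof -
    have "(\<lambda>n. inverse (of_real (s - t)) * (w s n - w t n) - v n) \<in> E_space \<beta>"
      by (intro E_norm_diff E_norm_scale wE vE s t)
    then have yE: "y s \<in> E_space \<beta>"
      by (simp add: y_def[abs_def] divide_inverse mult.commute)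
    have eq: "(\<lambda>n. w s n - w t n) = (\<lambda>n. of_real (s - t) * (y s n + v n))"
      using s(2) by (auto simp: y_def simp flip: of_real_diff)
    have "E_norm \<beta> (\<lambda>n. w s n - w t n) = \<bar>s - t\<bar> * E_norm \<beta> (\<lambda>n. y s n + v n)"
      unfolding eq by (subst E_norm_scale(2)) (auto intro!: E_norm_add yE vE simp flip: of_real_diff)
    also have "\<dots> \<le> \<bar>s - t\<bar> * (E_norm \<beta> (y s) + E_norm \<beta> v)"
      by (intro mult_left_mono E_norm_add yE vE) simp
    finally show ?thesis .
  qed
  show ?thesis
    by (rule tendsto_sandwich[OF _ _ tendsto_const lim0])
      (auto simp: eventually_at_filter E_norm_nonneg diffE le)
qed

lemma E_continuous_norm:
  assumes lim: "((\<lambda>s. E_norm \<beta> (\<lambda>n. w s n - w t n)) \<longlongrightarrow> 0) (at t within I)"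
    and wE: "\<And>s. s \<in> I \<Longrightarrow> w s \<in> E_space \<beta>" and t: "t \<in> I"
  shows "((\<lambda>s. E_norm \<beta> (w s)) \<longlongrightarrow> E_norm \<beta> (w t)) (at t within I)"
proof -
  have "((\<lambda>s. E_norm \<beta> (w s) - E_norm \<beta> (w t)) \<longlongrightarrow> 0) (at t within I)"
  proof (rule Lim_null_comparison[OF _ lim])
    show "\<forall>\<^sub>F s in at t within I. norm (E_norm \<beta> (w s) - E_norm \<beta> (w t)) \<le> E_norm \<beta> (\<lambda>n. w s n - w t n)"
      unfolding eventually_at_filter real_norm_def
      by (intro always_eventually allI impI E_norm_reverse_triangle wE t)
  qed
  then show ?thesis by (simp add: LIM_zero_iff)
qed

text \<open>Coordinatewise differentiability says nothing about uniformity in the coordinates; that comes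
  from the continuity of the candidate derivative in norm. On finitely many coordinates the mean value
  inequality bounds the error of the difference quotient by the oscillation of \<open>v\<close> near \<open>t\<close>, and this
  bound does not depend on how many coordinates are taken.\<close>

lemma has_E_derivative_coordinatewise:
  assumes I: "convex I" and t: "t \<in> I"
    and uE: "\<And>s. s \<in> I \<Longrightarrow> u s \<in> E_space \<beta>"
    and v: "E_continuous_on \<beta> I v"
    and deriv: "\<And>n s. s \<in> I \<Longrightarrow> ((\<lambda>r. u r n) has_vector_derivative v s n) (at s within I)"
  shows "has_E_derivative \<beta> I u (v t) t"
proof -
  define z where "z s n = (u s n - u t n) / of_real (s - t) - v t n" for s n
  have vE: "\<And>s. s \<in> I \<Longrightarrow> v s \<in> E_space \<beta>"
    and vlim: "((\<lambda>s. E_norm \<beta> (\<lambda>n. v s n - v t n)) \<longlongrightarrow> 0) (at t within I)"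
    using v t by (auto simp: E_continuous_on_def)
  have "((\<lambda>s. E_norm \<beta> (z s)) \<longlongrightarrow> 0) (at t within I)"
  proof (rule tendstoI)
    fix e :: real assume e: "0 < e"
    have "\<forall>\<^sub>F s in at t within I. dist (E_norm \<beta> (\<lambda>n. v s n - v t n)) 0 < e / 2"
      using vlim e by (intro tendstoD) auto
    then obtain \<delta> where \<delta>: "0 < \<delta>"
      "\<And>s. s \<in> I \<Longrightarrow> s \<noteq> t \<Longrightarrow> dist s t < \<delta> \<Longrightarrow> \<bar>E_norm \<beta> (\<lambda>n. v s n - v t n)\<bar> < e / 2"
      by (auto simp: eventually_at)
    have \<delta>': "E_norm \<beta> (\<lambda>n. v s n - v t n) \<le> e / 2" if "s \<in> I" "dist s t < \<delta>" for s
    proof (cases "s = t")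
      case True
      then show ?thesis using e by (simp add: E_norm_def)
    next
      case False
      then show ?thesis using \<delta>(2)[OF that(1) False that(2)] by simp
    qed
    have main: "z s \<in> E_space \<beta>" "E_norm \<beta> (z s) \<le> e / 2"
      if s: "s \<in> I" "s \<noteq> t" "dist s t < \<delta>" for s
    proof -
      define S where "S = I \<inter> ball t \<delta>"
      have S: "convex S" "s \<in> S" "t \<in> S"
        using I s t \<delta>(1) by (auto simp: S_def convex_Int dist_commute)
      have "(\<Sum>n<m. cmod (z s n) * exp (\<beta> * real n)) \<le> e / 2" for m
      proof -
        \<comment> \<open>Pairing with the conjugate signs turns the weighted norm of the difference quotient
          into one scalar increment.\<close>
        define \<sigma> where "\<sigma> n = cnj (sgn (z s n)) * of_real (exp (\<beta> * real n))" for n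
        define F where "F r = (\<Sum>n<m. \<sigma> n * (u r n - of_real r * v t n))" for r
        define F' where "F' r = (\<Sum>n<m. \<sigma> n * (v r n - v t n))" for r
        have sgn_le: "cmod (sgn (z s n)) \<le> 1" for n by (simp add: norm_sgn)
        have dF: "(F has_derivative (\<lambda>h. h *\<^sub>R F' r)) (at r within S)" if "r \<in> S" for r
        proof -
          have "((\<lambda>r. u r n) has_vector_derivative v r n) (at r within S)" for n
            using deriv[of r n] that unfolding S_def
            by (auto intro: has_vector_derivative_within_subset)
          then have "((\<lambda>r. \<sigma> n * (u r n - of_real r * v t n)) has_vector_derivative
              \<sigma> n * (v r n - v t n)) (at r within S)" for n
            by (auto intro!: derivative_eq_intros simp: has_vector_derivative_of_real)
          then have "(F has_vector_derivative F' r) (at r within S)"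
            unfolding F_def F'_def by (intro has_vector_derivative_sum)
          then show ?thesis by (simp add: has_vector_derivative_def)
        qed
        have F'_le: "onorm (\<lambda>h::real. h *\<^sub>R F' r) \<le> e / 2" if "r \<in> S" for r
        proof -
          have "onorm (\<lambda>h::real. h *\<^sub>R F' r) = norm (F' r)"
            using onorm_scaleR_left[OF bounded_linear_ident, of "F' r"] by (simp add: onorm_id)
          also have "\<dots> \<le> (\<Sum>n<m. cmod (\<sigma> n * (v r n - v t n)))"
            unfolding F'_def by (rule norm_sum)
          also have "\<dots> \<le> (\<Sum>n<m. cmod (v r n - v t n) * exp (\<beta> * real n))"
          proof (rule sum_mono)
            fix n
            have "cmod (\<sigma> n * (v r n - v t n))
                = cmod (sgn (z s n)) * (cmod (v r n - v t n) * exp (\<beta> * real n))"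
              by (simp add: \<sigma>_def norm_mult)
            also have "\<dots> \<le> 1 * (cmod (v r n - v t n) * exp (\<beta> * real n))"
              by (intro mult_right_mono sgn_le) auto
            finally show "cmod (\<sigma> n * (v r n - v t n)) \<le> cmod (v r n - v t n) * exp (\<beta> * real n)"
              by simp
          qed
          also have "\<dots> \<le> E_norm \<beta> (\<lambda>n. v r n - v t n)"
            using that t by (intro partial_sum_le_E_norm E_norm_diff vE) (auto simp: S_def)
          also have "\<dots> \<le> e / 2"
            using that by (intro \<delta>') (auto simp: S_def dist_commute)
          finally show ?thesis .
        qed
        have "F s - F t = of_real (s - t) * (\<Sum>n<m. of_real (cmod (z s n) * exp (\<beta> * real n)))"
        proof -
          have "\<sigma> n * (u s n - of_real s * v t n) - \<sigma> n * (u t n - of_real t * v t n)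
              = of_real (s - t) * of_real (cmod (z s n) * exp (\<beta> * real n))" for n
          proof -
            have "\<sigma> n * (u s n - of_real s * v t n) - \<sigma> n * (u t n - of_real t * v t n)
                = of_real (s - t) * (\<sigma> n * z s n)"
              using s(2) by (simp add: z_def field_simps)
            moreover have "cnj (sgn (z s n)) * z s n = of_real (cmod (z s n))"
            proof (cases "z s n = 0")
              case False
              have "cnj (z s n) * z s n = of_real (cmod (z s n)) * of_real (cmod (z s n))"
                using complex_norm_square[of "z s n"] by (simp add: power2_eq_square mult.commute)
              then show ?thesis using False
                by (simp add: sgn_div_norm scaleR_conv_of_real divide_simps)
            qed simp
            ultimately show ?thesis by (simp add: \<sigma>_def mult_ac)
          qed
          then show ?thesis
            by (simp add: F_def sum_distrib_left flip: sum_subtractf)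
        qed
        then have "norm (F s - F t) = \<bar>s - t\<bar> * (\<Sum>n<m. cmod (z s n) * exp (\<beta> * real n))"
          by (simp add: norm_mult abs_mult abs_of_nonneg sum_nonneg
              flip: of_real_sum of_real_diff of_real_mult)
        moreover have "norm (F s - F t) \<le> e / 2 * norm (s - t)"
          by (rule differentiable_bound[OF S(1) dF F'_le S(2,3)])
        ultimately show ?thesis using s(2) by (simp add: mult.commute[of "e / 2"])
      qed
      then show "z s \<in> E_space \<beta>" "E_norm \<beta> (z s) \<le> e / 2"
        by (rule E_norm_leI)+
    qed
    have "dist (E_norm \<beta> (z s)) 0 < e" if "s \<in> I" "s \<noteq> t" "dist s t < \<delta>" for s
      using main[OF that] E_norm_nonneg[of "z s" \<beta>] e by simp
    then show "\<forall>\<^sub>F s in at t within I. dist (E_norm \<beta> (z s)) 0 < e"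
      using \<delta>(1) by (auto simp: eventually_at)
  qed
  then show ?thesis
    unfolding has_E_derivative_def z_def[abs_def] using uE vE t by auto
qed

lemma E_continuous_on_bounded:
  assumes u: "E_continuous_on \<alpha> I u" and I: "{s..t} \<subseteq> I"
  obtains K where "\<And>r. r \<in> {s..t} \<Longrightarrow> E_norm \<alpha> (u r) \<le> K"
proof -
  have "continuous_on {s..t} (\<lambda>r. E_norm \<alpha> (u r))"
    unfolding continuous_on_def
  proof
    fix r assume "r \<in> {s..t}"
    then have r: "r \<in> I" using I by auto
    have "((\<lambda>r. E_norm \<alpha> (u r)) \<longlongrightarrow> E_norm \<alpha> (u r)) (at r within I)"
      by (rule E_continuous_norm[OF _ _ r]) (use u r in \<open>auto simp: E_continuous_on_def\<close>)
    then show "((\<lambda>r. E_norm \<alpha> (u r)) \<longlongrightarrow> E_norm \<alpha> (u r)) (at r within {s..t})"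
      by (rule tendsto_within_subset[OF _ I])
  qed
  then have "compact ((\<lambda>r. E_norm \<alpha> (u r)) ` {s..t})"
    by (intro compact_continuous_image compact_Icc)
  then have "bdd_above ((\<lambda>r. E_norm \<alpha> (u r)) ` {s..t})"
    by (intro bounded_imp_bdd_above compact_imp_bounded)
  then obtain K where "\<forall>r\<in>{s..t}. E_norm \<alpha> (u r) \<le> K" by (auto simp: bdd_above_def)
  then show thesis using that by blast
qed

lemma has_E_derivative_imp_E_continuous_on:
  assumes "\<And>t. t \<in> I \<Longrightarrow> has_E_derivative \<alpha> I u (v t) t"
  shows "E_continuous_on \<alpha> I u"
  unfolding E_continuous_on_def
  using assms has_E_derivative_continuous[OF assms] by (auto simp: has_E_derivative_def)

lemma has_E_derivative_diff:
  assumes u: "has_E_derivative \<alpha> I u u' t" and v: "has_E_derivative \<alpha> I v v' t" and t: "t \<in> I"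
  shows "has_E_derivative \<alpha> I (\<lambda>s n. u s n - v s n) (\<lambda>n. u' n - v' n) t"
proof -
  define y where "y w w' s n = (w s n - w t n) / of_real (s - t) - w' n"
    for w :: "real \<Rightarrow> nat \<Rightarrow> complex" and w' :: "nat \<Rightarrow> complex" and s n
  have yE: "y w w' s \<in> E_space \<alpha>" if "has_E_derivative \<alpha> I w w' t" "s \<in> I" for w w' s
  proof -
    have "(\<lambda>n. inverse (of_real (s - t)) * (w s n - w t n) - w' n) \<in> E_space \<alpha>"
      using that t by (intro E_norm_diff E_norm_scale) (auto simp: has_E_derivative_def)
    then show ?thesis by (simp add: y_def[abs_def] divide_inverse mult.commute)
  qed
  have eq: "(u s n - v s n - (u t n - v t n)) / of_real (s - t) - (u' n - v' n)
      = y u u' s n - y v v' s n" for s n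
    unfolding y_def by (simp add: diff_divide_distrib)
  have lim: "((\<lambda>s. E_norm \<alpha> (y u u' s) + E_norm \<alpha> (y v v' s)) \<longlongrightarrow> 0 + 0) (at t within I)"
    using u v by (intro tendsto_add) (simp_all add: has_E_derivative_def y_def[abs_def])
  have "((\<lambda>s. E_norm \<alpha> (\<lambda>n. y u u' s n - y v v' s n)) \<longlongrightarrow> 0) (at t within I)"
  proof (rule tendsto_sandwich[OF _ _ tendsto_const lim[simplified]])
    show "\<forall>\<^sub>F s in at t within I. 0 \<le> E_norm \<alpha> (\<lambda>n. y u u' s n - y v v' s n)"
      unfolding eventually_at_filter
      by (intro always_eventually allI impI E_norm_nonneg E_norm_diff yE u v)
    show "\<forall>\<^sub>F s in at t within I. E_norm \<alpha> (\<lambda>n. y u u' s n - y v v' s n)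
        \<le> E_norm \<alpha> (y u u' s) + E_norm \<alpha> (y v v' s)"
      unfolding eventually_at_filter
      by (intro always_eventually allI impI E_norm_diff yE u v)
  qed
  then show ?thesis
    unfolding has_E_derivative_def eq
    using u v by (auto simp: has_E_derivative_def intro!: E_norm_diff)
qed

text \<open>Completeness in the quantitative form needed here: the limit is taken in each coordinate, and
  the Cauchy rate survives because it bounds every partial sum.\<close>

lemma E_Cauchy_limit:
  assumes f: "\<And>N. f N \<in> E_space \<alpha>"
    and Cauchy: "\<And>N N'. N \<le> N' \<Longrightarrow> E_norm \<alpha> (\<lambda>n. f N n - f N' n) \<le> \<eta> N"
    and \<eta>: "\<eta> \<longlonglongrightarrow> 0"
  shows "(\<lambda>N. f N n) \<longlonglongrightarrow> lim (\<lambda>N. f N n)"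
    and "(\<lambda>n. f N n - lim (\<lambda>N. f N n)) \<in> E_space \<alpha>"
    and "E_norm \<alpha> (\<lambda>n. f N n - lim (\<lambda>N. f N n)) \<le> \<eta> N"
    and "(\<lambda>n. lim (\<lambda>N. f N n)) \<in> E_space \<alpha>"
proof -
  have lim: "(\<lambda>N. f N n) \<longlonglongrightarrow> lim (\<lambda>N. f N n)" for n
  proof -
    have le: "cmod (f N n - f N' n) \<le> \<eta> N * exp (- (\<alpha> * real n))" if "N \<le> N'" for N N'
    proof -
      have "cmod (f N n - f N' n) * exp (\<alpha> * real n) \<le> \<eta> N"
        by (rule order_trans[OF coordinate_le_E_norm[OF E_norm_diff(1)[OF f f]] Cauchy[OF that]])
      then show ?thesis by (simp add: exp_minus field_simps)
    qed
    have "Cauchy (\<lambda>N. f N n)"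
    proof (rule CauchyI')
      fix e :: real assume "0 < e"
      have "\<forall>\<^sub>F N in sequentially. \<eta> N * exp (- (\<alpha> * real n)) < e"
        by (rule order_tendstoD(2)[OF tendsto_mult_left_zero[OF \<eta>] \<open>0 < e\<close>])
      then obtain N0 where "\<And>N. N0 \<le> N \<Longrightarrow> \<eta> N * exp (- (\<alpha> * real n)) < e"
        by (auto simp: eventually_sequentially)
      then show "\<exists>N0. \<forall>N\<ge>N0. \<forall>N'>N. dist (f N n) (f N' n) < e"
        unfolding dist_norm using le by (meson le_less_trans less_imp_le)
    qed
    then show ?thesis using Cauchy_convergent_iff convergent_LIMSEQ_iff by blast
  qed
  then show "(\<lambda>N. f N n) \<longlonglongrightarrow> lim (\<lambda>N. f N n)" .
  have *: "(\<Sum>n<m. cmod (f N n - lim (\<lambda>N. f N n)) * exp (\<alpha> * real n)) \<le> \<eta> N" for m N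
  proof (rule LIMSEQ_le_const2)
    show "(\<lambda>N'. \<Sum>n<m. cmod (f N n - f N' n) * exp (\<alpha> * real n))
        \<longlonglongrightarrow> (\<Sum>n<m. cmod (f N n - lim (\<lambda>N. f N n)) * exp (\<alpha> * real n))"
      by (intro tendsto_intros lim)
    show "\<exists>N0. \<forall>N'\<ge>N0. (\<Sum>n<m. cmod (f N n - f N' n) * exp (\<alpha> * real n)) \<le> \<eta> N"
      using order_trans[OF partial_sum_le_E_norm[OF E_norm_diff(1)[OF f f]] Cauchy] by blast
  qed
  show d: "(\<lambda>n. f N n - lim (\<lambda>N. f N n)) \<in> E_space \<alpha>"
    and "E_norm \<alpha> (\<lambda>n. f N n - lim (\<lambda>N. f N n)) \<le> \<eta> N" for N
    by (rule E_norm_leI[OF *])+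
  show "(\<lambda>n. lim (\<lambda>N. f N n)) \<in> E_space \<alpha>"
    using E_norm_diff(1)[OF f d, of 0 0] by simp
qed

lemma E_continuous_uniform_limit:
  assumes f: "\<And>N. E_continuous_on \<alpha> I (f N)"
    and u: "\<And>t. t \<in> I \<Longrightarrow> u t \<in> E_space \<alpha>"
    and le: "\<And>N t. t \<in> I \<Longrightarrow> E_norm \<alpha> (\<lambda>n. f N t n - u t n) \<le> \<eta> N"
    and \<eta>: "\<eta> \<longlonglongrightarrow> 0"
  shows "E_continuous_on \<alpha> I u"
  unfolding E_continuous_on_def
proof (intro conjI ballI u)
  fix t assume t: "t \<in> I"
  have fE: "f N s \<in> E_space \<alpha>" if "s \<in> I" for N s
    using f[of N] that by (simp add: E_continuous_on_def)
  have tri: "E_norm \<alpha> (\<lambda>n. u s n - u t n) \<le> E_norm \<alpha> (\<lambda>n. f N s n - f N t n) + 2 * \<eta> N"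
    if s: "s \<in> I" for N s
  proof -
    have "E_norm \<alpha> (\<lambda>n. u s n - u t n)
        = E_norm \<alpha> (\<lambda>n. ((f N s n - f N t n) + (f N t n - u t n)) - (f N s n - u s n))"
      by simp
    also have "\<dots> \<le> E_norm \<alpha> (\<lambda>n. (f N s n - f N t n) + (f N t n - u t n))
        + E_norm \<alpha> (\<lambda>n. f N s n - u s n)"
      by (intro E_norm_diff E_norm_add fE u s t)
    also have "E_norm \<alpha> (\<lambda>n. (f N s n - f N t n) + (f N t n - u t n))
        \<le> E_norm \<alpha> (\<lambda>n. f N s n - f N t n) + E_norm \<alpha> (\<lambda>n. f N t n - u t n)"
      by (intro E_norm_diff E_norm_add fE u s t)
    finally show ?thesis using le[OF s, of N] le[OF t, of N] by simp
  qed
  show "((\<lambda>s. E_norm \<alpha> (\<lambda>n. u s n - u t n)) \<longlongrightarrow> 0) (at t within I)"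
  proof (rule tendstoI)
    fix e :: real assume e: "0 < e"
    have "\<forall>\<^sub>F N in sequentially. \<eta> N < e / 4"
      using \<eta> e by (intro order_tendstoD(2)[of \<eta> 0]) auto
    then obtain N where N: "\<eta> N < e / 4" by (auto simp: eventually_sequentially)
    have "\<forall>\<^sub>F s in at t within I. E_norm \<alpha> (\<lambda>n. f N s n - f N t n) < e / 4"
      using f[of N] t e by (intro order_tendstoD(2)[of _ 0]) (auto simp: E_continuous_on_def)
    then show "\<forall>\<^sub>F s in at t within I. dist (E_norm \<alpha> (\<lambda>n. u s n - u t n)) 0 < e"
      unfolding eventually_at_filter
    proof eventually_elim
      case (elim s)
      then show ?case
        using tri[of s N] N E_norm_nonneg[OF E_norm_diff(1)[OF u u[OF t]], of s] by auto
    qed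
  qed
qed

section \<open>Dissipativity\<close>

text \<open>A continuous function whose left derivatives are all negative cannot attain its maximum over an
  interval after the left end point. This is applied to \<open>\<phi> - \<psi>\<close> minus a small multiple of the time.
  Left derivatives are used because the norm estimate below is available only for backward
  differences.\<close>

lemma left_derivative_comparison:
  fixes \<phi> \<psi> \<psi>' :: "real \<Rightarrow> real"
  assumes ab: "a \<le> b"
    and cont: "continuous_on {a..b} \<phi>"
    and deriv: "\<And>r. r \<in> {a..b} \<Longrightarrow> (\<psi> has_real_derivative \<psi>' r) (at r within {a..b})"
    and init: "\<phi> a \<le> \<psi> a"
    and left: "\<And>r e. a < r \<Longrightarrow> r \<le> b \<Longrightarrow> 0 < e \<Longrightarrow>
      \<exists>\<delta>>0. \<forall>s\<in>{a..b}. r - \<delta> < s \<and> s < r \<longrightarrow> \<phi> r - \<phi> s \<le> (r - s) * (\<psi>' r + e)"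
  shows "\<phi> b \<le> \<psi> b"
proof (rule ccontr)
  assume "\<not> \<phi> b \<le> \<psi> b"
  then have gap: "0 < \<phi> b - \<psi> b" by simp
  \<comment> \<open>Small enough that subtracting \<open>3 * e * (r - a)\<close> below keeps the value at \<open>b\<close> positive.\<close>
  define e where "e = (\<phi> b - \<psi> b) / (6 * (b - a + 1))"
  define \<eta> where "\<eta> r = \<phi> r - \<psi> r - 3 * e * (r - a)" for r
  have e: "0 < e" using gap ab by (auto simp: e_def)
  have "6 * (b - a + 1) * e = \<phi> b - \<psi> b"
    using ab by (simp add: e_def)
  then have "3 * e * (b - a) + 3 * e * (b - a) + 6 * e = \<phi> b - \<psi> b"
    by (simp add: algebra_simps)
  moreover have "0 \<le> 3 * e * (b - a)" using e ab by simp
  ultimately have \<eta>b: "0 < \<eta> b" using e unfolding \<eta>_def by linarith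
  have "continuous_on {a..b} \<psi>"
    using deriv by (rule DERIV_continuous_on)
  then have "continuous_on {a..b} \<eta>"
    unfolding \<eta>_def by (intro continuous_intros cont)
  then obtain r where r: "r \<in> {a..b}" and max: "\<And>s. s \<in> {a..b} \<Longrightarrow> \<eta> s \<le> \<eta> r"
    using continuous_attains_sup[of "{a..b}" \<eta>] ab by auto
  have "\<eta> a \<le> 0" using init by (simp add: \<eta>_def)
  then have ar: "a < r" using max[of b] \<eta>b ab r by (cases "r = a") auto
  obtain \<delta>1 where \<delta>1: "0 < \<delta>1"
    "\<And>s. s \<in> {a..b} \<Longrightarrow> r - \<delta>1 < s \<Longrightarrow> s < r \<Longrightarrow> \<phi> r - \<phi> s \<le> (r - s) * (\<psi>' r + e)"
    using left[OF ar _ e] r by auto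
  have "(\<psi> has_derivative (*) (\<psi>' r)) (at r within {a..b})"
    using deriv[OF r] by (simp add: has_field_derivative_def)
  then obtain \<delta>2 where \<delta>2: "0 < \<delta>2"
    "\<And>s. s \<in> {a..b} \<Longrightarrow> \<bar>s - r\<bar> < \<delta>2 \<Longrightarrow> \<bar>\<psi> s - \<psi> r - \<psi>' r * (s - r)\<bar> \<le> e * \<bar>s - r\<bar>"
    unfolding has_derivative_within_alt using e by fastforce
  define s where "s = max a (r - min \<delta>1 \<delta>2 / 2)"
  have s: "s \<in> {a..b}" "s < r" "r - \<delta>1 < s" "\<bar>s - r\<bar> < \<delta>2"
    using \<delta>1(1) \<delta>2(1) ar r by (auto simp: s_def)
  have "\<phi> r - \<phi> s \<le> (r - s) * \<psi>' r + (r - s) * e"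
    using \<delta>1(2)[OF s(1,3,2)] by (simp add: algebra_simps)
  moreover have "(r - s) * \<psi>' r - (r - s) * e \<le> \<psi> r - \<psi> s"
    using \<delta>2(2)[OF s(1,4)] s(2) by (simp add: algebra_simps abs_le_iff)
  moreover have "\<eta> r - \<eta> s = (\<phi> r - \<phi> s) - (\<psi> r - \<psi> s) - 3 * ((r - s) * e)"
    by (simp add: \<eta>_def algebra_simps)
  moreover have "0 < (r - s) * e" using s(2) e by simp
  moreover have "\<eta> s \<le> \<eta> r" by (rule max[OF s(1)])
  ultimately show False by linarith
qed

text \<open>If \<open>w' = - D w + f\<close>, then \<open>(1 + h D) w(t)\<close> equals \<open>w(t - h) + h f\<close> up to \<open>o(h)\<close>. The norm of the
  left-hand side is exactly \<open>\<parallel>w(t)\<parallel> + h \<parallel>D w(t)\<parallel>\<close>, because the norm is a weighted sum of absolute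
  values and \<open>1 + h D\<close> is diagonal with positive entries. So the part of \<open>f\<close> that is no larger than
  \<open>D w\<close> does not contribute to the growth of the norm.\<close>

lemma dissipative_left_derivative:
  assumes deriv: "has_E_derivative \<beta> I w v t" and t: "t \<in> I"
    and v: "\<And>n. v n = - of_real (d n) * w t n + f n"
    and d: "\<And>n. 0 \<le> d n"
    and Dw: "(\<lambda>n. of_real (d n) * w t n) \<in> E_space \<beta>"
    and f: "f \<in> E_space \<beta>" "E_norm \<beta> f \<le> E_norm \<beta> (\<lambda>n. of_real (d n) * w t n) + \<gamma>"
    and e: "0 < e"
  shows "\<exists>\<delta>>0. \<forall>s\<in>I. t - \<delta> < s \<and> s < t \<longrightarrow>
    E_norm \<beta> (w t) - E_norm \<beta> (w s) \<le> (t - s) * (\<gamma> + e)"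
proof -
  define y where "y s n = (w s n - w t n) / of_real (s - t) - v n" for s n
  have wE: "\<And>s. s \<in> I \<Longrightarrow> w s \<in> E_space \<beta>" and vE: "v \<in> E_space \<beta>"
    and lim: "((\<lambda>s. E_norm \<beta> (y s)) \<longlongrightarrow> 0) (at t within I)"
    using deriv by (auto simp: has_E_derivative_def y_def[abs_def])
  have "\<forall>\<^sub>F s in at t within I. dist (E_norm \<beta> (y s)) 0 < e"
    using lim e by (rule tendstoD)
  then obtain \<delta> where \<delta>: "0 < \<delta>"
    "\<And>s. s \<in> I \<Longrightarrow> s \<noteq> t \<Longrightarrow> dist s t < \<delta> \<Longrightarrow> \<bar>E_norm \<beta> (y s)\<bar> < e"
    by (auto simp: eventually_at)
  have "E_norm \<beta> (w t) - E_norm \<beta> (w s) \<le> (t - s) * (\<gamma> + e)"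
    if s: "s \<in> I" "t - \<delta> < s" "s < t" for s
  proof -
    define h where "h = t - s"
    have h: "0 < h" using s by (simp add: h_def)
    have yE: "y s \<in> E_space \<beta>"
    proof -
      have "(\<lambda>n. inverse (of_real (s - t)) * (w s n - w t n) - v n) \<in> E_space \<beta>"
        by (intro E_norm_diff E_norm_scale wE vE s t)
      then show ?thesis by (simp add: y_def[abs_def] divide_inverse mult.commute)
    qed
    have ye: "E_norm \<beta> (y s) < e"
      using \<delta>(2)[OF s(1)] s by (auto simp: dist_real_def)
    \<comment> \<open>The backward difference is an implicit Euler step, so \<open>d\<close> enters with a good sign.\<close>
    have step: "of_real (1 + h * d n) * w t n = w s n + (of_real h * f n + of_real h * y s n)" for n
    proof -
      have "of_real (s - t) * y s n = (w s n - w t n) - of_real (s - t) * v n"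
      proof -
        have "complex_of_real (s - t) \<noteq> 0" using s(3) by simp
        then show ?thesis unfolding y_def right_diff_distrib by simp
      qed
      then show ?thesis unfolding v h_def by (simp add: algebra_simps)
    qed
    have "E_norm \<beta> (\<lambda>n. of_real (1 + h * d n) * w t n)
        = E_norm \<beta> (w t) + h * E_norm \<beta> (\<lambda>n. of_real (d n) * w t n)"
    proof -
      have "cmod (of_real (1 + h * d n) * w t n) * exp (\<beta> * real n)
          = cmod (w t n) * exp (\<beta> * real n)
            + h * (cmod (of_real (d n) * w t n) * exp (\<beta> * real n))" for n
        using h d[of n] unfolding norm_mult norm_of_real by (simp add: algebra_simps)
      then show ?thesis
        unfolding E_norm_def
        by (simp only: suminf_add[OF E_spaceD[OF wE[OF t]]
              summable_mult[OF E_spaceD[OF Dw]], symmetric]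
            suminf_mult[OF E_spaceD[OF Dw], symmetric])
    qed
    moreover have "E_norm \<beta> (\<lambda>n. of_real (1 + h * d n) * w t n)
        \<le> E_norm \<beta> (w s) + (h * E_norm \<beta> f + h * E_norm \<beta> (y s))"
    proof -
      have "E_norm \<beta> (\<lambda>n. of_real (1 + h * d n) * w t n)
          \<le> E_norm \<beta> (w s) + E_norm \<beta> (\<lambda>n. of_real h * f n + of_real h * y s n)"
        unfolding step by (intro E_norm_add E_norm_scale wE f yE s)
      also have "E_norm \<beta> (\<lambda>n. of_real h * f n + of_real h * y s n)
          \<le> E_norm \<beta> (\<lambda>n. of_real h * f n) + E_norm \<beta> (\<lambda>n. of_real h * y s n)"
        by (intro E_norm_add E_norm_scale f yE)
      also have "\<dots> = h * E_norm \<beta> f + h * E_norm \<beta> (y s)"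
        using h by (simp add: E_norm_scale f yE)
      finally show ?thesis by simp
    qed
    moreover have "h * E_norm \<beta> f \<le> h * E_norm \<beta> (\<lambda>n. of_real (d n) * w t n) + h * \<gamma>"
      using mult_left_mono[OF f(2), of h] h by (simp add: distrib_left)
    moreover have "h * E_norm \<beta> (y s) \<le> h * e" using ye h by simp
    ultimately have "E_norm \<beta> (w t) - E_norm \<beta> (w s) \<le> h * \<gamma> + h * e" by linarith
    then show ?thesis by (simp add: h_def distrib_left)
  qed
  then show ?thesis using \<delta>(1) by blast
qed

section \<open>The generator and its boundedness between weighted spaces\<close>

text \<open>The column conditions are recorded for partial sums, since in this form they pass at once to
  restrictions of the matrices.\<close>

locale weighted_system =
  fixes d :: "nat \<Rightarrow> real" and b c :: "nat \<Rightarrow> nat \<Rightarrow> complex"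
    and \<alpha>s :: real and M :: "real \<Rightarrow> real"
  assumes d_nonneg: "0 \<le> d n"
    and d_growth: "0 < \<nu> \<Longrightarrow> \<exists>K. \<forall>n. d n \<le> K * exp (\<nu> * real n)"
    and b_column: "\<alpha>s < \<beta> \<Longrightarrow>
      (\<Sum>n<m. cmod (b n k) * exp (\<beta> * real n)) \<le> d k * exp (\<beta> * real k)"
    and c_column: "\<alpha>s < \<beta> \<Longrightarrow> \<beta> < \<gamma> \<Longrightarrow>
      (\<Sum>n<m. cmod (c n k) * exp (\<beta> * real n)) \<le> M \<gamma> / (\<gamma> - \<beta>) * exp (\<gamma> * real k)"
    and M_pos: "\<alpha>s < \<beta> \<Longrightarrow> 0 < M \<beta>"
    and M_mono: "\<alpha>s < \<beta> \<Longrightarrow> \<beta> \<le> \<gamma> \<Longrightarrow> M \<beta> \<le> M \<gamma>"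
begin

definition generator :: "(nat \<Rightarrow> complex) \<Rightarrow> nat \<Rightarrow> complex" where
  "generator u n = - of_real (d n) * u n + (matrix_op b u n + matrix_op c u n)"

lemma diagonal_bounded:
  assumes "\<beta> < \<gamma>"
  obtains K where "0 \<le> K"
    and "\<And>u. u \<in> E_space \<gamma> \<Longrightarrow> (\<lambda>n. of_real (d n) * u n) \<in> E_space \<beta>"
    and "\<And>u. u \<in> E_space \<gamma> \<Longrightarrow> E_norm \<beta> (\<lambda>n. of_real (d n) * u n) \<le> K * E_norm \<gamma> u"
proof -
  obtain K where K: "\<And>n. d n \<le> K * exp ((\<gamma> - \<beta>) * real n)"
    using d_growth[of "\<gamma> - \<beta>"] assms by auto
  have "0 \<le> K" using K[of 0] d_nonneg[of 0] by simp
  moreover have "cmod (of_real (d n) * u n) * exp (\<beta> * real n)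
      \<le> K * (cmod (u n) * exp (\<gamma> * real n))" for n and u :: "nat \<Rightarrow> complex"
  proof -
    have "d n * (cmod (u n) * exp (\<beta> * real n))
        \<le> K * exp ((\<gamma> - \<beta>) * real n) * (cmod (u n) * exp (\<beta> * real n))"
      by (intro mult_right_mono K) auto
    also have "\<dots> = K * (cmod (u n) * (exp ((\<gamma> - \<beta>) * real n) * exp (\<beta> * real n)))"
      by (simp only: mult_ac)
    also have "exp ((\<gamma> - \<beta>) * real n) * exp (\<beta> * real n) = exp (\<gamma> * real n)"
      by (simp add: algebra_simps flip: exp_add)
    finally show ?thesis using d_nonneg[of n] by (simp add: norm_mult mult_ac)
  qed
  ultimately show thesis
    using E_norm_dominated[where \<alpha>=\<beta> and \<beta>=\<gamma> and r=K] by (intro that[of K]) auto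
qed

lemma b_bounded:
  assumes \<beta>: "\<alpha>s < \<beta>" "\<beta> < \<gamma>" and u: "u \<in> E_space \<gamma>"
  shows "summable (\<lambda>k. b n k * u k)"
    and "matrix_op b u \<in> E_space \<beta>"
    and "E_norm \<beta> (matrix_op b u) \<le> E_norm \<beta> (\<lambda>n. of_real (d n) * u n)"
proof -
  have Du: "(\<lambda>n. of_real (d n) * u n) \<in> E_space \<beta>"
    using diagonal_bounded[OF \<beta>(2)] u by metis
  have eq: "(\<lambda>k. d k * exp (\<beta> * real k) * cmod (u k))
      = (\<lambda>k. cmod (of_real (d k) * u k) * exp (\<beta> * real k))"
    using d_nonneg by (auto simp: norm_mult)
  have "summable (\<lambda>k. d k * exp (\<beta> * real k) * cmod (u k))"
    unfolding eq by (rule E_spaceD[OF Du])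
  note * = matrix_op_column_bound[OF b_column[OF \<beta>(1)] this]
  show "summable (\<lambda>k. b n k * u k)" "matrix_op b u \<in> E_space \<beta>"
    by (rule *)+
  show "E_norm \<beta> (matrix_op b u) \<le> E_norm \<beta> (\<lambda>n. of_real (d n) * u n)"
    using *(3) unfolding eq by (simp add: E_norm_def)
qed

lemma c_bounded:
  assumes \<beta>: "\<alpha>s < \<beta>" "\<beta> < \<gamma>" and u: "u \<in> E_space \<gamma>"
  shows "summable (\<lambda>k. c n k * u k)"
    and "matrix_op c u \<in> E_space \<beta>"
    and "E_norm \<beta> (matrix_op c u) \<le> M \<gamma> / (\<gamma> - \<beta>) * E_norm \<gamma> u"
proof -
  have eq: "(\<lambda>k. M \<gamma> / (\<gamma> - \<beta>) * exp (\<gamma> * real k) * cmod (u k))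
      = (\<lambda>k. M \<gamma> / (\<gamma> - \<beta>) * (cmod (u k) * exp (\<gamma> * real k)))"
    by (simp add: mult_ac)
  have "summable (\<lambda>k. M \<gamma> / (\<gamma> - \<beta>) * exp (\<gamma> * real k) * cmod (u k))"
    unfolding eq by (intro summable_mult E_spaceD u)
  note * = matrix_op_column_bound[OF c_column[OF \<beta>] this]
  show "summable (\<lambda>k. c n k * u k)" "matrix_op c u \<in> E_space \<beta>"
    by (rule *)+
  show "E_norm \<beta> (matrix_op c u) \<le> M \<gamma> / (\<gamma> - \<beta>) * E_norm \<gamma> u"
    using *(3) unfolding eq suminf_mult[OF E_spaceD[OF u]] by (simp add: E_norm_def)
qed

lemma generator_bounded:
  assumes \<beta>: "\<alpha>s < \<beta>" "\<beta> < \<gamma>"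
  obtains K where "0 \<le> K"
    and "\<And>u. u \<in> E_space \<gamma> \<Longrightarrow> generator u \<in> E_space \<beta>"
    and "\<And>u. u \<in> E_space \<gamma> \<Longrightarrow> E_norm \<beta> (generator u) \<le> K * E_norm \<gamma> u"
proof -
  obtain K where K: "0 \<le> K"
    "\<And>u. u \<in> E_space \<gamma> \<Longrightarrow> (\<lambda>n. of_real (d n) * u n) \<in> E_space \<beta>"
    "\<And>u. u \<in> E_space \<gamma> \<Longrightarrow> E_norm \<beta> (\<lambda>n. of_real (d n) * u n) \<le> K * E_norm \<gamma> u"
    using diagonal_bounded[OF \<beta>(2)] by blast
  have eq: "generator u = (\<lambda>n. (matrix_op b u n + matrix_op c u n) - of_real (d n) * u n)" for u
    by (auto simp: generator_def)
  have "0 < M \<gamma>" using M_pos \<beta> by simp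
  moreover have "generator u \<in> E_space \<beta>" if u: "u \<in> E_space \<gamma>" for u
    unfolding eq by (intro E_norm_diff E_norm_add b_bounded[OF \<beta> u] c_bounded[OF \<beta> u] K u)
  moreover have "E_norm \<beta> (generator u) \<le> (2 * K + M \<gamma> / (\<gamma> - \<beta>)) * E_norm \<gamma> u"
    if u: "u \<in> E_space \<gamma>" for u
  proof -
    note B = b_bounded[OF \<beta> u] and C = c_bounded[OF \<beta> u]
    have "E_norm \<beta> (generator u) \<le> E_norm \<beta> (\<lambda>n. matrix_op b u n + matrix_op c u n)
        + E_norm \<beta> (\<lambda>n. of_real (d n) * u n)"
      unfolding eq by (intro E_norm_diff E_norm_add B C K u)
    also have "E_norm \<beta> (\<lambda>n. matrix_op b u n + matrix_op c u n)
        \<le> E_norm \<beta> (matrix_op b u) + E_norm \<beta> (matrix_op c u)"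
      by (intro E_norm_add B C)
    finally show ?thesis using B(3) C(3) K(3)[OF u] by (simp add: algebra_simps)
  qed
  ultimately show thesis using K(1) \<beta>(2) by (intro that[of "2 * K + M \<gamma> / (\<gamma> - \<beta>)"]) auto
qed

lemma generator_diff:
  assumes "\<alpha>s < \<gamma>" and u: "u \<in> E_space \<gamma>" and v: "v \<in> E_space \<gamma>"
  shows "generator (\<lambda>n. u n - v n) n = generator u n - generator v n"
proof -
  have \<beta>: "\<alpha>s < (\<alpha>s + \<gamma>) / 2" "(\<alpha>s + \<gamma>) / 2 < \<gamma>" using assms(1) by auto
  have b: "matrix_op b (\<lambda>n. u n - v n) n = matrix_op b u n - matrix_op b v n"
    unfolding matrix_op_def right_diff_distrib
    by (intro suminf_diff[symmetric] b_bounded[OF \<beta> u] b_bounded[OF \<beta> v])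
  have c: "matrix_op c (\<lambda>n. u n - v n) n = matrix_op c u n - matrix_op c v n"
    unfolding matrix_op_def right_diff_distrib
    by (intro suminf_diff[symmetric] c_bounded[OF \<beta> u] c_bounded[OF \<beta> v])
  show ?thesis unfolding generator_def b c by (simp add: algebra_simps)
qed

lemma matrix_op_eq_generator:
  assumes a: "\<And>n k. a n k = - (if n = k then of_real (d n) else 0) + b n k + c n k"
    and "\<alpha>s < \<gamma>" and u: "u \<in> E_space \<gamma>"
  shows "matrix_op a u = generator u"
proof
  fix n
  have \<beta>: "\<alpha>s < (\<alpha>s + \<gamma>) / 2" "(\<alpha>s + \<gamma>) / 2 < \<gamma>" using assms(2) by auto
  have "(\<lambda>k. if k = n then - of_real (d k) * u k else 0) sums (- of_real (d n) * u n)"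
    by (rule sums_single)
  from sums_add[OF this sums_add[OF summable_sums[OF b_bounded(1)[OF \<beta> u, of n]]
      summable_sums[OF c_bounded(1)[OF \<beta> u, of n]]]]
  have "(\<lambda>k. (if k = n then - of_real (d k) * u k else 0) + (b n k * u k + c n k * u k))
      sums generator u n"
    by (simp only: generator_def matrix_op_def)
  moreover have "(if k = n then - of_real (d k) * u k else 0) + (b n k * u k + c n k * u k)
      = a n k * u k" for k
    by (simp add: a algebra_simps)
  ultimately show "matrix_op a u n = generator u n"
    by (simp add: matrix_op_def sums_iff)
qed

end

section \<open>A priori bound on a triangle of times and weights\<close>

context weighted_system
begin

text \<open>One round of the iteration. The majorant \<open>\<psi>\<close> is chosen so that its derivative, apart from \<open>\<epsilon>\<close>, is
  the bound for the growth rate of the norm when \<open>C w\<close> is estimated with \<open>h = (\<alpha> - \<beta> - \<mu> (r - s)) / 2\<close>: the rate is then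
  \<open>L N (\<alpha> - \<beta>) / h\<^sup>2\<close>, which is the derivative of \<open>4 L / \<mu> \<cdot> N (\<alpha> - \<beta>) / (\<alpha> - \<beta> - \<mu> (r - s))\<close>.\<close>

lemma a_priori_improvement:
  assumes I: "{s..t1} \<subseteq> I" and st: "s \<le> t1"
    and L: "0 < L" "4 * L < \<mu>" "\<And>\<beta>. \<alpha>s < \<beta> \<Longrightarrow> \<beta> < \<alpha> \<Longrightarrow> M \<beta> \<le> L"
    and wE: "\<And>r. r \<in> {s..t1} \<Longrightarrow> w r \<in> E_space \<alpha>"
    and X: "E_norm \<alpha> (w s) \<le> X"
    and g: "\<And>\<beta> r. \<alpha>s < \<beta> \<Longrightarrow> \<beta> < \<alpha> \<Longrightarrow> r \<in> {s..t1} \<Longrightarrow> \<mu> * (r - s) < \<alpha> - \<beta> \<Longrightarrow>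
      g r \<in> E_space \<beta> \<and> E_norm \<beta> (g r) \<le> \<epsilon>"
    and deriv: "\<And>\<beta> r. \<alpha>s < \<beta> \<Longrightarrow> \<beta> < \<alpha> \<Longrightarrow> r \<in> {s..t1} \<Longrightarrow>
      has_E_derivative \<beta> I w (\<lambda>n. generator (w r) n + g r n) r"
    and N: "0 \<le> N" "\<And>\<beta> r. \<alpha>s < \<beta> \<Longrightarrow> \<beta> < \<alpha> \<Longrightarrow> r \<in> {s..t1} \<Longrightarrow> \<mu> * (r - s) < \<alpha> - \<beta> \<Longrightarrow>
      E_norm \<beta> (w r) * (\<alpha> - \<beta> - \<mu> * (r - s)) \<le> N * (\<alpha> - \<beta>)"
    and \<beta>: "\<alpha>s < \<beta>" "\<beta> < \<alpha>" and t: "t \<in> {s..t1}" "\<mu> * (t - s) < \<alpha> - \<beta>"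
  shows "E_norm \<beta> (w t) * (\<alpha> - \<beta> - \<mu> * (t - s))
    \<le> (X + \<epsilon> * (t1 - s) + 4 * L / \<mu> * N) * (\<alpha> - \<beta>)"
proof -
  have \<mu>: "0 < \<mu>" using L by simp
  define \<rho> where "\<rho> r = \<alpha> - \<beta> - \<mu> * (r - s)" for r
  define \<psi> where "\<psi> r = X + \<epsilon> * (r - s) + 4 * L / \<mu> * N * (\<alpha> - \<beta>) / \<rho> r" for r
  define \<psi>' where "\<psi>' r = \<epsilon> + 4 * L * N * (\<alpha> - \<beta>) / (\<rho> r)\<^sup>2" for r
  have \<rho>: "0 < \<rho> r" "\<rho> r \<le> \<alpha> - \<beta>" if "r \<in> {s..t}" for r
  proof -
    have "\<mu> * (r - s) \<le> \<mu> * (t - s)" "0 \<le> \<mu> * (r - s)" using \<mu> that by auto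
    then show "0 < \<rho> r" "\<rho> r \<le> \<alpha> - \<beta>" using t(2) by (auto simp: \<rho>_def)
  qed
  have sub: "r \<in> {s..t1}" if "r \<in> {s..t}" for r using that t by auto
  have "E_norm \<beta> (w t) \<le> \<psi> t"
  proof (rule left_derivative_comparison[where \<phi>="\<lambda>r. E_norm \<beta> (w r)" and \<psi>'=\<psi>' and a=s])
    show "s \<le> t" using t by simp
    show "continuous_on {s..t} (\<lambda>r. E_norm \<beta> (w r))"
      unfolding continuous_on_def
    proof
      fix r assume r: "r \<in> {s..t}"
      note D = deriv[OF \<beta> sub[OF r]]
      have rI: "r \<in> I" using sub[OF r] I by auto
      have "((\<lambda>r. E_norm \<beta> (w r)) \<longlongrightarrow> E_norm \<beta> (w r)) (at r within I)"
        by (rule E_continuous_norm[OF has_E_derivative_continuous[OF D rI] _ rI])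
          (use D in \<open>auto simp: has_E_derivative_def\<close>)
      then show "((\<lambda>r. E_norm \<beta> (w r)) \<longlongrightarrow> E_norm \<beta> (w r)) (at r within {s..t})"
        by (rule tendsto_within_subset) (use I sub in auto)
    qed
    show "(\<psi> has_real_derivative \<psi>' r) (at r within {s..t})" if r: "r \<in> {s..t}" for r
    proof -
      have "\<rho> r \<noteq> 0" using \<rho>(1)[OF r] by simp
      then show ?thesis
        unfolding \<psi>_def \<psi>'_def \<rho>_def using \<mu>
        by (auto intro!: derivative_eq_intros simp: power2_eq_square)
    qed
    show "E_norm \<beta> (w s) \<le> \<psi> s"
    proof -
      have "E_norm \<beta> (w s) \<le> E_norm \<alpha> (w s)"
        using \<beta> st by (intro E_norm_mono wE) auto
      moreover have "0 \<le> 4 * L / \<mu> * N" using L \<mu> N by simp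
      ultimately show ?thesis using X \<beta> by (simp add: \<psi>_def \<rho>_def)
    qed
    fix r e :: real assume r: "s < r" "r \<le> t" and e: "0 < e"
    have r': "r \<in> {s..t}" "r \<in> {s..t1}" using r t by auto
    \<comment> \<open>Half of the remaining room is spent on the loss of weight in \<open>c\<close>; this
      makes the room left at the index \<open>\<beta> + h\<close> equal to \<open>h\<close>.\<close>
    define h where "h = \<rho> r / 2"
    have h: "0 < h" "\<beta> + h < \<alpha>" "\<mu> * (r - s) = \<alpha> - \<beta> - 2 * h"
    proof -
      have "2 * h = \<alpha> - \<beta> - \<mu> * (r - s)" by (simp add: h_def \<rho>_def)
      moreover have "0 < h" "2 * h \<le> \<alpha> - \<beta>" using \<rho>[OF r'(1)] by (auto simp: h_def)
      ultimately show "0 < h" "\<beta> + h < \<alpha>" "\<mu> * (r - s) = \<alpha> - \<beta> - 2 * h"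
        using \<beta> by linarith+
    qed
    have \<beta>h: "\<alpha>s < \<beta> + h" using h \<beta> by simp
    have wr: "w r \<in> E_space (\<beta> + h)" using wE[OF r'(2)] h(2) by (rule E_space_antimono[OF _ less_imp_le])
    have wr': "\<beta> < \<beta> + h" using h by simp
    have gr: "g r \<in> E_space \<beta>" "E_norm \<beta> (g r) \<le> \<epsilon>"
      using g[OF \<beta> r'(2)] h by auto
    have "E_norm (\<beta> + h) (w r) * (\<alpha> - (\<beta> + h) - \<mu> * (r - s)) \<le> N * (\<alpha> - (\<beta> + h))"
      using h by (intro N(2)[OF \<beta>h h(2) r'(2)]) auto
    also have "\<alpha> - (\<beta> + h) - \<mu> * (r - s) = h" using h(3) by simp
    also have "N * (\<alpha> - (\<beta> + h)) \<le> N * (\<alpha> - \<beta>)" using N(1) h(1) by (intro mult_left_mono) auto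
    finally have w_le: "E_norm (\<beta> + h) (w r) \<le> N * (\<alpha> - \<beta>) / h"
      using h(1) by (simp add: pos_le_divide_eq)
    have C_le: "E_norm \<beta> (matrix_op c (w r)) \<le> L / h * (N * (\<alpha> - \<beta>) / h)"
    proof -
      have "E_norm \<beta> (matrix_op c (w r)) \<le> M (\<beta> + h) / (\<beta> + h - \<beta>) * E_norm (\<beta> + h) (w r)"
        by (rule c_bounded(3)[OF \<beta>(1) wr' wr])
      also have "\<dots> \<le> L / h * (N * (\<alpha> - \<beta>) / h)"
        using L(1) L(3)[OF \<beta>h h(2)] h(1)
        by (intro mult_mono w_le E_norm_nonneg wr) (auto intro!: divide_right_mono)
      finally show ?thesis .
    qed
    have "\<psi>' r = \<epsilon> + L / h * (N * (\<alpha> - \<beta>) / h)"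
      by (simp add: \<psi>'_def h_def power2_eq_square)
    then have bound: "E_norm \<beta> (matrix_op c (w r)) + E_norm \<beta> (g r) \<le> \<psi>' r"
      using C_le gr(2) by simp
    define f where "f n = matrix_op b (w r) n + (matrix_op c (w r) n + g r n)" for n
    note B = b_bounded[OF \<beta>(1) wr' wr] and C = c_bounded[OF \<beta>(1) wr' wr]
    have fE: "f \<in> E_space \<beta>"
      unfolding f_def[abs_def] by (intro E_norm_add B C gr)
    have "E_norm \<beta> f \<le> E_norm \<beta> (matrix_op b (w r)) + E_norm \<beta> (\<lambda>n. matrix_op c (w r) n + g r n)"
      unfolding f_def[abs_def] by (intro E_norm_add B C gr)
    also have "E_norm \<beta> (\<lambda>n. matrix_op c (w r) n + g r n)
        \<le> E_norm \<beta> (matrix_op c (w r)) + E_norm \<beta> (g r)"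
      by (intro E_norm_add B C gr)
    finally have f_le: "E_norm \<beta> f \<le> E_norm \<beta> (\<lambda>n. of_real (d n) * w r n) + \<psi>' r"
      using bound B(3) by simp
    have Dw: "(\<lambda>n. of_real (d n) * w r n) \<in> E_space \<beta>"
      using diagonal_bounded[OF wr'] wr by metis
    have "\<exists>\<delta>>0. \<forall>s'\<in>I. r - \<delta> < s' \<and> s' < r \<longrightarrow>
        E_norm \<beta> (w r) - E_norm \<beta> (w s') \<le> (r - s') * (\<psi>' r + e)"
      using r'(2) I
      by (intro dissipative_left_derivative[OF deriv[OF \<beta> r'(2)] _ _ d_nonneg Dw fE f_le e])
        (auto simp: generator_def f_def)
    then show "\<exists>\<delta>>0. \<forall>s'\<in>{s..t}. r - \<delta> < s' \<and> s' < r \<longrightarrow>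
        E_norm \<beta> (w r) - E_norm \<beta> (w s') \<le> (r - s') * (\<psi>' r + e)"
      using sub I by blast
  qed
  then have "E_norm \<beta> (w t) * \<rho> t \<le> \<psi> t * \<rho> t"
    using \<rho>[of t] t by (intro mult_right_mono) auto
  also have "\<dots> = (X + \<epsilon> * (t - s)) * \<rho> t + 4 * L / \<mu> * N * (\<alpha> - \<beta>)"
    using \<rho>(1)[of t] t by (simp add: \<psi>_def distrib_right)
  also have "\<dots> \<le> (X + \<epsilon> * (t1 - s)) * (\<alpha> - \<beta>) + 4 * L / \<mu> * N * (\<alpha> - \<beta>)"
  proof -
    have "0 \<le> X" using order_trans[OF E_norm_nonneg[OF wE] X] st by simp
    moreover have "0 \<le> \<epsilon>"
      using g[OF \<beta> t] E_norm_nonneg[of "g t" \<beta>] by auto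
    ultimately show ?thesis
      using t \<rho>[of t] by (intro add_right_mono mult_mono add_left_mono mult_left_mono) auto
  qed
  finally show ?thesis by (simp add: \<rho>_def distrib_right)
qed

text \<open>The crude bound \<open>K\<close> starts the iteration, whose contraction factor is \<open>4 L / \<mu> < 1\<close>. In the
  limit \<open>K\<close> drops out, so the final bound depends only on the initial value and on the source
  inside the triangle.\<close>

lemma a_priori_bound:
  assumes I: "{s..t1} \<subseteq> I" and st: "s \<le> t1"
    and L: "0 < L" "4 * L < \<mu>" "\<And>\<beta>. \<alpha>s < \<beta> \<Longrightarrow> \<beta> < \<alpha> \<Longrightarrow> M \<beta> \<le> L"
    and wE: "\<And>r. r \<in> {s..t1} \<Longrightarrow> w r \<in> E_space \<alpha>"
    and K: "\<And>r. r \<in> {s..t1} \<Longrightarrow> E_norm \<alpha> (w r) \<le> K"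
    and X: "E_norm \<alpha> (w s) \<le> X"
    and \<epsilon>: "0 \<le> \<epsilon>"
    and g: "\<And>\<beta> r. \<alpha>s < \<beta> \<Longrightarrow> \<beta> < \<alpha> \<Longrightarrow> r \<in> {s..t1} \<Longrightarrow> \<mu> * (r - s) < \<alpha> - \<beta> \<Longrightarrow>
      g r \<in> E_space \<beta> \<and> E_norm \<beta> (g r) \<le> \<epsilon>"
    and deriv: "\<And>\<beta> r. \<alpha>s < \<beta> \<Longrightarrow> \<beta> < \<alpha> \<Longrightarrow> r \<in> {s..t1} \<Longrightarrow>
      has_E_derivative \<beta> I w (\<lambda>n. generator (w r) n + g r n) r"
    and \<beta>: "\<alpha>s < \<beta>" "\<beta> < \<alpha>" and t: "t \<in> {s..t1}" "\<mu> * (t - s) < \<alpha> - \<beta>"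
  shows "E_norm \<beta> (w t) * (\<alpha> - \<beta> - \<mu> * (t - s))
    \<le> (X + \<epsilon> * (t1 - s)) / (1 - 4 * L / \<mu>) * (\<alpha> - \<beta>)"
proof -
  define \<kappa> where "\<kappa> = 4 * L / \<mu>"
  define Y where "Y = X + \<epsilon> * (t1 - s)"
  have \<mu>: "0 < \<mu>" using L by simp
  have \<kappa>: "0 \<le> \<kappa>" "\<kappa> < 1" using L \<mu> by (auto simp: \<kappa>_def)
  have X0: "0 \<le> X" using order_trans[OF E_norm_nonneg[OF wE] X] st by simp
  have K0: "0 \<le> K" using order_trans[OF E_norm_nonneg[OF wE[of s]] K[of s]] st by simp
  have Y0: "0 \<le> Y" unfolding Y_def using X0 \<epsilon> st by simp
  have *: "E_norm \<beta> (w t) * (\<alpha> - \<beta> - \<mu> * (t - s)) \<le> (Y / (1 - \<kappa>) + \<kappa> ^ j * K) * (\<alpha> - \<beta>)"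
    if "\<alpha>s < \<beta>" "\<beta> < \<alpha>" "t \<in> {s..t1}" "\<mu> * (t - s) < \<alpha> - \<beta>" for \<beta> t j
    using that
  proof (induction j arbitrary: \<beta> t)
    case (0 \<beta> t)
    have "E_norm \<beta> (w t) \<le> K"
      using 0 by (intro order_trans[OF E_norm_mono K] wE) auto
    moreover have "0 \<le> Y / (1 - \<kappa>)" using Y0 \<kappa> by simp
    moreover have "0 \<le> \<mu> * (t - s)" using \<mu> 0 by simp
    ultimately show ?case using 0 K0 by (intro mult_mono) auto
  next
    case (Suc j \<beta> t)
    have "E_norm \<beta> (w t) * (\<alpha> - \<beta> - \<mu> * (t - s))
        \<le> (X + \<epsilon> * (t1 - s) + 4 * L / \<mu> * (Y / (1 - \<kappa>) + \<kappa> ^ j * K)) * (\<alpha> - \<beta>)"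
    proof (rule a_priori_improvement[OF I st L wE X g deriv _ Suc.IH Suc.prems])
      show "0 \<le> Y / (1 - \<kappa>) + \<kappa> ^ j * K" using Y0 \<kappa> K0 by simp
    qed
    also have "X + \<epsilon> * (t1 - s) + 4 * L / \<mu> * (Y / (1 - \<kappa>) + \<kappa> ^ j * K)
        = Y / (1 - \<kappa>) + \<kappa> ^ Suc j * K"
      using \<kappa>(2) unfolding \<kappa>_def[symmetric] Y_def[symmetric] by (simp add: field_simps)
    finally show ?case .
  qed
  have "(\<lambda>j. (Y / (1 - \<kappa>) + \<kappa> ^ j * K) * (\<alpha> - \<beta>)) \<longlonglongrightarrow> (Y / (1 - \<kappa>) + 0 * K) * (\<alpha> - \<beta>)"
    using \<kappa> by (intro tendsto_intros LIMSEQ_realpow_zero)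
  then have "E_norm \<beta> (w t) * (\<alpha> - \<beta> - \<mu> * (t - s)) \<le> (Y / (1 - \<kappa>) + 0 * K) * (\<alpha> - \<beta>)"
    by (rule LIMSEQ_le_const) (use *[OF \<beta> t] in blast)
  then show ?thesis by (simp add: Y_def \<kappa>_def)
qed

end

section \<open>Restricted matrices and truncated systems\<close>

lemma finite_support_E_norm:
  assumes "\<And>n. N \<le> n \<Longrightarrow> u n = 0"
  shows "u \<in> E_space \<alpha>" and "E_norm \<alpha> u = (\<Sum>n<N. cmod (u n) * exp (\<alpha> * real n))"
proof -
  show "u \<in> E_space \<alpha>"
    unfolding E_space_def by (intro CollectI summable_finite[of "{..<N}"]) (simp_all add: assms)
  show "E_norm \<alpha> u = (\<Sum>n<N. cmod (u n) * exp (\<alpha> * real n))"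
    unfolding E_norm_def using assms by (intro suminf_finite) auto
qed

text \<open>The solution is the exponential series of the matrix, summed in each coordinate: the Taylor
  coefficients are obtained by iterating the matrix, and the series is entire because its coefficients
  grow at most geometrically before division by the factorials.\<close>

lemma finite_linear_ode:
  fixes A :: "nat \<Rightarrow> nat \<Rightarrow> complex"
  obtains u :: "real \<Rightarrow> nat \<Rightarrow> complex"
  where "\<And>n. n < N \<Longrightarrow> u 0 n = x n" and "\<And>t n. N \<le> n \<Longrightarrow> u t n = 0"
    and "\<And>t n. n < N \<Longrightarrow>
      ((\<lambda>s. u s n) has_vector_derivative (\<Sum>k<N. A n k * u t k)) (at t)"
proof -
  define y where "y = rec_nat x (\<lambda>_ z n. \<Sum>k<N. A n k * z k)"
  have y0: "y 0 = x" and ySuc: "y (Suc m) n = (\<Sum>k<N. A n k * y m k)" for m n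
    by (simp_all add: y_def)
  define R where "R = (\<Sum>n<N. \<Sum>k<N. cmod (A n k))"
  define X where "X = (\<Sum>k<N. cmod (x k))"
  have R: "0 \<le> R" unfolding R_def by (intro sum_nonneg) auto
  have ybound: "(\<Sum>n<N. cmod (y m n)) \<le> R ^ m * X" for m
  proof (induction m)
    case 0
    show ?case by (simp add: y0 X_def)
  next
    case (Suc m)
    have "(\<Sum>n<N. cmod (y (Suc m) n)) \<le> (\<Sum>n<N. \<Sum>k<N. cmod (A n k) * (\<Sum>i<N. cmod (y m i)))"
      unfolding ySuc
    proof (intro sum_mono order_trans[OF norm_sum])
      fix n k assume "k \<in> {..<N}"
      then have "cmod (y m k) \<le> (\<Sum>i<N. cmod (y m i))"
        by (intro member_le_sum) auto
      then show "cmod (A n k * y m k) \<le> cmod (A n k) * (\<Sum>i<N. cmod (y m i))"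
        by (simp add: norm_mult mult_left_mono)
    qed
    also have "\<dots> = R * (\<Sum>i<N. cmod (y m i))"
      by (simp add: R_def sum_distrib_right)
    also have "\<dots> \<le> R * (R ^ m * X)" by (intro mult_left_mono Suc.IH R)
    finally show ?case by simp
  qed
  have sm: "summable (\<lambda>m. y m n / fact m * z ^ m)" if n: "n < N" for n and z :: complex
  proof (rule summable_comparison_test'[where N=0])
    show "summable (\<lambda>m. (R * cmod z) ^ m / fact m * X)"
      using summable_mult2[OF summable_exp[of "R * cmod z"], of X]
      by (simp add: divide_inverse mult_ac)
    fix m
    have "cmod (y m n) \<le> (\<Sum>n<N. cmod (y m n))"
      using n by (intro member_le_sum) auto
    also have "\<dots> \<le> R ^ m * X" by (rule ybound)
    finally have "cmod (y m n) * (cmod z ^ m / fact m) \<le> R ^ m * X * (cmod z ^ m / fact m)"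
      by (rule mult_right_mono) simp
    then show "norm (y m n / fact m * z ^ m) \<le> (R * cmod z) ^ m / fact m * X"
      by (simp add: norm_mult norm_divide norm_power power_mult_distrib mult_ac)
  qed
  define w where "w z n = (\<Sum>m. y m n / fact m * z ^ m)" for z :: complex and n
  define u where "u t n = (if n < N then w (of_real t) n else 0)" for t n
  have deriv: "((\<lambda>z. w z n) has_field_derivative (\<Sum>k<N. A n k * w z k)) (at z)"
    if n: "n < N" for n z
  proof -
    have "((\<lambda>z. w z n) has_field_derivative (\<Sum>m. diffs (\<lambda>m. y m n / fact m) m * z ^ m)) (at z)"
      unfolding w_def by (rule termdiffs_strong_converges_everywhere) (rule sm[OF n])
    also have "(\<lambda>m. diffs (\<lambda>m. y m n / fact m) m * z ^ m)
        = (\<lambda>m. \<Sum>k<N. A n k * (y m k / fact m * z ^ m))"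
    proof
      fix m
      have "diffs (\<lambda>m. y m n / fact m) m = y (Suc m) n / fact m"
        by (simp add: diffs_def field_simps del: of_nat_Suc)
      then show "diffs (\<lambda>m. y m n / fact m) m * z ^ m = (\<Sum>k<N. A n k * (y m k / fact m * z ^ m))"
        by (simp add: ySuc sum_distrib_left sum_divide_distrib mult_ac)
    qed
    also have "(\<Sum>m. \<Sum>k<N. A n k * (y m k / fact m * z ^ m))
        = (\<Sum>k<N. \<Sum>m. A n k * (y m k / fact m * z ^ m))"
      by (intro suminf_sum summable_mult sm) simp
    also have "\<dots> = (\<Sum>k<N. A n k * w z k)"
      unfolding w_def by (intro sum.cong refl suminf_mult sm) simp
    finally show ?thesis .
  qed
  show thesis
  proof (rule that[of u])
    show "u 0 n = x n" if "n < N" for n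
    proof -
      have "w 0 n = (\<Sum>m. if m = 0 then x n else 0)"
        unfolding w_def by (intro suminf_cong) (simp add: y0)
      also have "\<dots> = x n" using sums_unique[OF sums_single[of 0 "\<lambda>_. x n"]] by simp
      finally show ?thesis using that by (simp add: u_def)
    qed
    show "u t n = 0" if "N \<le> n" for t n using that by (simp add: u_def)
    show "((\<lambda>s. u s n) has_vector_derivative (\<Sum>k<N. A n k * u t k)) (at t)" if "n < N" for t n
      using has_vector_derivative_real_field[OF deriv[OF that, of "of_real t"], of UNIV] that
      by (simp add: u_def)
  qed
qed

definition restrict_matrix ::
  "nat set \<Rightarrow> (nat \<Rightarrow> nat \<Rightarrow> complex) \<Rightarrow> nat \<Rightarrow> nat \<Rightarrow> complex" where
  "restrict_matrix S A n k = (if n \<in> S \<and> k \<in> S then A n k else 0)"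

lemma restrict_matrix_UNIV: "restrict_matrix UNIV A = A"
  by (intro ext) (simp add: restrict_matrix_def)

lemma restrict_matrix_column:
  assumes "(\<Sum>n<m. cmod (A n k) * w n) \<le> B" and "\<And>n. 0 \<le> w n"
  shows "(\<Sum>n<m. cmod (restrict_matrix S A n k) * w n) \<le> B"
  by (rule order_trans[OF sum_mono assms(1)])
    (auto simp: restrict_matrix_def assms(2) intro!: mult_right_mono)

text \<open>An entry on which the two restrictions differ has a row or a column index of at least \<open>N\<close>, so
  \<open>exp (\<nu> n + \<nu> k)\<close> is at least \<open>exp (\<nu> N)\<close> there.\<close>

lemma restrict_matrix_diff_column:
  assumes S: "{..<N} \<subseteq> S" "{..<N} \<subseteq> S'" and \<nu>: "0 < \<nu>"
    and col: "(\<Sum>n<m. cmod (A n k) * exp ((\<beta> + \<nu>) * real n)) \<le> V"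
  shows "(\<Sum>n<m. cmod (restrict_matrix S A n k - restrict_matrix S' A n k) * exp (\<beta> * real n))
    \<le> exp (- \<nu> * real N) * exp (\<nu> * real k) * V"
proof -
  have le: "cmod (restrict_matrix S A n k - restrict_matrix S' A n k) * exp (\<beta> * real n)
      \<le> exp (- \<nu> * real N) * exp (\<nu> * real k) * (cmod (A n k) * exp ((\<beta> + \<nu>) * real n))" for n
  proof (cases "n < N \<and> k < N")
    case True
    then have "restrict_matrix S A n k - restrict_matrix S' A n k = 0"
      using S by (auto simp: restrict_matrix_def)
    then show ?thesis by simp
  next
    case False
    have "real N \<le> real k + real n" using False by auto
    then have "\<nu> * real N \<le> \<nu> * (real k + real n)" using \<nu> by simp
    then have "\<beta> * real n \<le> - \<nu> * real N + (\<nu> * real k + (\<beta> + \<nu>) * real n)"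
      by (simp add: algebra_simps)
    then have "exp (\<beta> * real n) \<le> exp (- \<nu> * real N) * (exp (\<nu> * real k) * exp ((\<beta> + \<nu>) * real n))"
      by (simp only: exp_add[symmetric] exp_le_cancel_iff)
    moreover have "cmod (restrict_matrix S A n k - restrict_matrix S' A n k) \<le> cmod (A n k)"
      by (auto simp: restrict_matrix_def)
    ultimately have "cmod (restrict_matrix S A n k - restrict_matrix S' A n k) * exp (\<beta> * real n)
        \<le> cmod (A n k) * (exp (- \<nu> * real N) * (exp (\<nu> * real k) * exp ((\<beta> + \<nu>) * real n)))"
      by (intro mult_mono) auto
    then show ?thesis by (simp only: mult_ac)
  qed
  have "(\<Sum>n<m. cmod (restrict_matrix S A n k - restrict_matrix S' A n k) * exp (\<beta> * real n))
      \<le> (\<Sum>n<m. exp (- \<nu> * real N) * exp (\<nu> * real k) * (cmod (A n k) * exp ((\<beta> + \<nu>) * real n)))"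
    by (intro sum_mono le)
  also have "\<dots> \<le> exp (- \<nu> * real N) * exp (\<nu> * real k) * V"
    unfolding sum_distrib_left[symmetric] by (intro mult_left_mono col) auto
  finally show ?thesis .
qed

lemma restrict_matrix_op_close:
  assumes S: "{..<N} \<subseteq> S" "{..<N} \<subseteq> S'" and \<nu>: "0 < \<nu>"
    and col: "\<And>m k. (\<Sum>n<m. cmod (A n k) * exp ((\<beta> + \<nu>) * real n)) \<le> K * exp (\<gamma> * real k)"
    and u: "u \<in> E_space (\<gamma> + \<nu>)"
    and sm: "\<And>n. summable (\<lambda>k. restrict_matrix S A n k * u k)"
      "\<And>n. summable (\<lambda>k. restrict_matrix S' A n k * u k)"
  shows "(\<lambda>n. matrix_op (restrict_matrix S A) u n - matrix_op (restrict_matrix S' A) u n)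
      \<in> E_space \<beta>"
    and "E_norm \<beta> (\<lambda>n. matrix_op (restrict_matrix S A) u n - matrix_op (restrict_matrix S' A) u n)
      \<le> exp (- \<nu> * real N) * K * E_norm (\<gamma> + \<nu>) u"
proof -
  define W where "W k = exp (- \<nu> * real N) * exp (\<nu> * real k) * (K * exp (\<gamma> * real k))" for k
  have W: "W k * cmod (u k) = exp (- \<nu> * real N) * K * (cmod (u k) * exp ((\<gamma> + \<nu>) * real k))" for k
    by (simp add: W_def distrib_right exp_add)
  have W_sum: "summable (\<lambda>k. W k * cmod (u k))"
    unfolding W by (intro summable_mult E_spaceD u)
  have W_col: "(\<Sum>n<m. cmod (restrict_matrix S A n k - restrict_matrix S' A n k)
      * exp (\<beta> * real n)) \<le> W k" for m k
    unfolding W_def by (rule restrict_matrix_diff_column[OF S \<nu> col])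
  note * = matrix_op_column_bound[where
      A="\<lambda>n k. restrict_matrix S A n k - restrict_matrix S' A n k", OF W_col W_sum]
  have eq: "(\<lambda>n. matrix_op (restrict_matrix S A) u n - matrix_op (restrict_matrix S' A) u n)
      = matrix_op (\<lambda>n k. restrict_matrix S A n k - restrict_matrix S' A n k) u"
    unfolding matrix_op_def left_diff_distrib by (intro ext suminf_diff sm)
  show "(\<lambda>n. matrix_op (restrict_matrix S A) u n - matrix_op (restrict_matrix S' A) u n)
      \<in> E_space \<beta>"
    unfolding eq by (rule *(2))
  show "E_norm \<beta> (\<lambda>n. matrix_op (restrict_matrix S A) u n - matrix_op (restrict_matrix S' A) u n)
      \<le> exp (- \<nu> * real N) * K * E_norm (\<gamma> + \<nu>) u"
    using *(3) unfolding eq W suminf_mult[OF E_spaceD[OF u]] by (simp add: E_norm_def)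
qed

context weighted_system
begin

lemma weighted_system_restrict:
  "weighted_system d (restrict_matrix S b) (restrict_matrix S c) \<alpha>s M"
proof
  show "(\<Sum>n<m. cmod (restrict_matrix S b n k) * exp (\<beta> * real n)) \<le> d k * exp (\<beta> * real k)"
    if "\<alpha>s < \<beta>" for \<beta> m k
    by (rule restrict_matrix_column[OF b_column[OF that]]) simp
  show "(\<Sum>n<m. cmod (restrict_matrix S c n k) * exp (\<beta> * real n))
      \<le> M \<gamma> / (\<gamma> - \<beta>) * exp (\<gamma> * real k)"
    if "\<alpha>s < \<beta>" "\<beta> < \<gamma>" for \<beta> \<gamma> m k
    by (rule restrict_matrix_column[OF c_column[OF that]]) simp
qed (rule d_nonneg d_growth M_pos M_mono; assumption)+

abbreviation restricted_generator :: "nat set \<Rightarrow> (nat \<Rightarrow> complex) \<Rightarrow> nat \<Rightarrow> complex" where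
  "restricted_generator S \<equiv>
     weighted_system.generator d (restrict_matrix S b) (restrict_matrix S c)"

text \<open>The constant does not depend on \<open>\<beta>\<close>, which matters because the a priori bound uses this
  estimate for all \<open>\<beta>\<close> at once. Of the loss \<open>3 \<nu>\<close> of weight, one \<open>\<nu>\<close> is spent on the decay in rows,
  one on the decay in columns, and one on the growth of \<open>d\<close> and on the singular bound for \<open>c\<close>.\<close>

lemma restricted_generator_close:
  assumes \<nu>: "0 < \<nu>"
  obtains C where "0 \<le> C"
    and "\<And>\<beta> S S' N u. \<alpha>s < \<beta> \<Longrightarrow> \<beta> + 3 * \<nu> \<le> \<gamma> \<Longrightarrow> {..<N} \<subseteq> S \<Longrightarrow> {..<N} \<subseteq> S' \<Longrightarrow>
      u \<in> E_space (\<beta> + 3 * \<nu>) \<Longrightarrow>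
      (\<lambda>n. restricted_generator S u n - restricted_generator S' u n) \<in> E_space \<beta> \<and>
      E_norm \<beta> (\<lambda>n. restricted_generator S u n - restricted_generator S' u n)
        \<le> C * exp (- \<nu> * real N) * E_norm (\<beta> + 3 * \<nu>) u"
proof -
  obtain K where K: "\<And>n. d n \<le> K * exp (\<nu> * real n)" using d_growth[OF \<nu>] by auto
  have K0: "0 \<le> K" using K[of 0] d_nonneg[of 0] by simp
  define C where "C = K + max 0 (M \<gamma> / \<nu>)"
  show thesis
  proof (rule that[of C])
    show "0 \<le> C" using K0 by (simp add: C_def)
    fix \<beta> :: real and S S' :: "nat set" and N and u
    assume \<beta>: "\<alpha>s < \<beta>" "\<beta> + 3 * \<nu> \<le> \<gamma>" and S: "{..<N} \<subseteq> S" "{..<N} \<subseteq> S'"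
      and u: "u \<in> E_space (\<beta> + 3 * \<nu>)"
    interpret S: weighted_system d "restrict_matrix S b" "restrict_matrix S c" \<alpha>s M
      by (rule weighted_system_restrict)
    interpret S': weighted_system d "restrict_matrix S' b" "restrict_matrix S' c" \<alpha>s M
      by (rule weighted_system_restrict)
    have lt: "\<beta> < \<beta> + 3 * \<nu>" using \<nu> by simp
    have three: "\<beta> + 2 * \<nu> + \<nu> = \<beta> + 3 * \<nu>" by simp
    have "(\<Sum>n<m. cmod (b n k) * exp ((\<beta> + \<nu>) * real n)) \<le> K * exp ((\<beta> + 2 * \<nu>) * real k)" for m k
    proof -
      have "(\<Sum>n<m. cmod (b n k) * exp ((\<beta> + \<nu>) * real n)) \<le> d k * exp ((\<beta> + \<nu>) * real k)"
        using \<beta> \<nu> by (intro b_column) auto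
      also have "\<dots> \<le> K * exp (\<nu> * real k) * exp ((\<beta> + \<nu>) * real k)"
        by (intro mult_right_mono K) auto
      also have "\<dots> = K * exp ((\<beta> + 2 * \<nu>) * real k)"
        by (simp add: algebra_simps flip: exp_add)
      finally show ?thesis .
    qed
    note B = restrict_matrix_op_close[OF S \<nu> this, unfolded three, OF u
        S.b_bounded(1)[OF \<beta>(1) lt u] S'.b_bounded(1)[OF \<beta>(1) lt u]]
    have "(\<Sum>n<m. cmod (c n k) * exp ((\<beta> + \<nu>) * real n))
        \<le> max 0 (M \<gamma> / \<nu>) * exp ((\<beta> + 2 * \<nu>) * real k)" for m k
    proof -
      have "(\<Sum>n<m. cmod (c n k) * exp ((\<beta> + \<nu>) * real n))
          \<le> M (\<beta> + 2 * \<nu>) / (\<beta> + 2 * \<nu> - (\<beta> + \<nu>)) * exp ((\<beta> + 2 * \<nu>) * real k)"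
        using \<beta> \<nu> by (intro c_column) auto
      also have "\<dots> \<le> max 0 (M \<gamma> / \<nu>) * exp ((\<beta> + 2 * \<nu>) * real k)"
      proof (rule mult_right_mono)
        have "M (\<beta> + 2 * \<nu>) \<le> M \<gamma>" using \<beta> \<nu> by (intro M_mono) auto
        then show "M (\<beta> + 2 * \<nu>) / (\<beta> + 2 * \<nu> - (\<beta> + \<nu>)) \<le> max 0 (M \<gamma> / \<nu>)"
          using \<nu> by (simp add: divide_right_mono le_max_iff_disj)
      qed simp
      finally show ?thesis .
    qed
    note C = restrict_matrix_op_close[OF S \<nu> this, unfolded three, OF u
        S.c_bounded(1)[OF \<beta>(1) lt u] S'.c_bounded(1)[OF \<beta>(1) lt u]]
    have eq: "restricted_generator S u n - restricted_generator S' u n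
        = (matrix_op (restrict_matrix S b) u n - matrix_op (restrict_matrix S' b) u n)
          + (matrix_op (restrict_matrix S c) u n - matrix_op (restrict_matrix S' c) u n)" for n
      by (simp add: S.generator_def S'.generator_def)
    have "E_norm \<beta> (\<lambda>n. restricted_generator S u n - restricted_generator S' u n)
        \<le> exp (- \<nu> * real N) * K * E_norm (\<beta> + 3 * \<nu>) u
          + exp (- \<nu> * real N) * max 0 (M \<gamma> / \<nu>) * E_norm (\<beta> + 3 * \<nu>) u"
      unfolding eq by (rule order_trans[OF E_norm_add(2)[OF B(1) C(1)] add_mono[OF B(2) C(2)]])
    moreover have "(\<lambda>n. restricted_generator S u n - restricted_generator S' u n) \<in> E_space \<beta>"
      unfolding eq by (rule E_norm_add(1)[OF B(1) C(1)])
    ultimately show "(\<lambda>n. restricted_generator S u n - restricted_generator S' u n) \<in> E_space \<beta> \<and>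
        E_norm \<beta> (\<lambda>n. restricted_generator S u n - restricted_generator S' u n)
          \<le> C * exp (- \<nu> * real N) * E_norm (\<beta> + 3 * \<nu>) u"
      by (simp add: C_def algebra_simps)
  qed
qed

text \<open>The coordinates from \<open>N\<close> on vanish, so the diagonal need not be cut off: it acts on them as
  zero.\<close>

lemma truncated_solution:
  obtains u :: "real \<Rightarrow> nat \<Rightarrow> complex"
  where "u 0 = (\<lambda>n. if n < N then x n else 0)"
    and "\<And>\<beta> t. u t \<in> E_space \<beta>"
    and "\<And>\<beta> t. has_E_derivative \<beta> UNIV u (restricted_generator {..<N} (u t)) t"
    and "\<And>n t. ((\<lambda>s. u s n) has_vector_derivative restricted_generator {..<N} (u t) n) (at t)"
proof -
  interpret R: weighted_system d "restrict_matrix {..<N} b" "restrict_matrix {..<N} c" \<alpha>s M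
    by (rule weighted_system_restrict)
  define A where "A n k = - (if n = k then of_real (d n) else 0) + (b n k + c n k)" for n k
  obtain u :: "real \<Rightarrow> nat \<Rightarrow> complex" where u:
    "\<And>n. n < N \<Longrightarrow> u 0 n = x n" "\<And>t n. N \<le> n \<Longrightarrow> u t n = 0"
    "\<And>t n. n < N \<Longrightarrow> ((\<lambda>s. u s n) has_vector_derivative (\<Sum>k<N. A n k * u t k)) (at t)"
    using finite_linear_ode[of N x A] by blast
  have gen: "restricted_generator {..<N} (u t) n = (if n < N then \<Sum>k<N. A n k * u t k else 0)"
    for t n
  proof -
    have op: "matrix_op (restrict_matrix {..<N} B) (u t) n
        = (if n < N then \<Sum>k<N. B n k * u t k else 0)" for B
    proof -
      have "matrix_op (restrict_matrix {..<N} B) (u t) n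
          = (\<Sum>k<N. restrict_matrix {..<N} B n k * u t k)"
        unfolding matrix_op_def by (intro suminf_finite) (auto simp: u(2))
      then show ?thesis by (simp add: restrict_matrix_def)
    qed
    have diag: "(\<Sum>k<N. (if n = k then of_real (d n) else 0) * u t k) = of_real (d n) * u t n"
      if "n < N" using that by (simp add: if_distrib[of "\<lambda>z. z * _"] cong: if_cong)
    show ?thesis
      by (auto simp: R.generator_def op u(2) A_def distrib_right sum.distrib diag
          left_diff_distrib sum_subtractf)
  qed
  have deriv: "((\<lambda>s. u s n) has_vector_derivative restricted_generator {..<N} (u t) n) (at t)" for n t
    using u(3)[of n t] by (auto simp: gen u(2))
  have uE: "u t \<in> E_space \<beta>" for t \<beta>
    using u(2) by (rule finite_support_E_norm)
  have cont: "E_continuous_on \<beta> UNIV (\<lambda>t. restricted_generator {..<N} (u t))" for \<beta>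
    unfolding E_continuous_on_def
  proof (intro conjI ballI)
    show "restricted_generator {..<N} (u t) \<in> E_space \<beta>" for t
      by (rule finite_support_E_norm[of N]) (simp add: gen)
    fix t
    have lim: "((\<lambda>s. u s n) \<longlongrightarrow> u t n) (at t)" for n
      using has_vector_derivative_continuous[OF deriv[of n t]] by (simp add: continuous_within)
    have norm: "E_norm \<beta> (\<lambda>n. restricted_generator {..<N} (u s) n - restricted_generator {..<N} (u t) n)
        = (\<Sum>n<N. cmod ((\<Sum>k<N. A n k * u s k) - (\<Sum>k<N. A n k * u t k)) * exp (\<beta> * real n))" for s
      by (subst finite_support_E_norm(2)[of N]) (auto simp: gen)
    have "((\<lambda>s. \<Sum>n<N. cmod ((\<Sum>k<N. A n k * u s k) - (\<Sum>k<N. A n k * u t k)) * exp (\<beta> * real n))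
        \<longlongrightarrow> (\<Sum>n<N. cmod ((\<Sum>k<N. A n k * u t k) - (\<Sum>k<N. A n k * u t k)) * exp (\<beta> * real n))) (at t)"
      by (intro tendsto_intros lim)
    then show "((\<lambda>s. E_norm \<beta> (\<lambda>n. restricted_generator {..<N} (u s) n - restricted_generator {..<N} (u t) n))
        \<longlongrightarrow> 0) (at t within UNIV)"
      unfolding norm by simp
  qed
  show thesis
  proof (rule that[of u])
    show "u 0 = (\<lambda>n. if n < N then x n else 0)" using u(1,2) by auto
    show "has_E_derivative \<beta> UNIV u (restricted_generator {..<N} (u t)) t" for \<beta> t
      by (rule has_E_derivative_coordinatewise[OF convex_UNIV _ uE cont]) (auto intro: deriv)
  qed (fact uE deriv)+
qed

end

section \<open>Existence\<close>

lemma exp_decay: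
  assumes "0 < \<nu>"
  shows "(\<lambda>N. exp (- \<nu> * real N)) \<longlonglongrightarrow> 0"
  unfolding exp_of_nat2_mult using assms by (intro LIMSEQ_realpow_zero) auto

context weighted_system
begin

text \<open>Both the uniform bound and the Cauchy estimate reach all times below \<open>(\<alpha> - \<alpha>') / \<mu>\<close>. The
  difference of two truncated solutions is treated from an index \<open>\<alpha>t\<close> strictly between \<open>\<alpha>' + \<mu> t1\<close> and
  \<open>\<alpha>\<close>: inside the smaller triangle below \<open>\<alpha>t\<close> the uniform bound holds with room to spare, so it can pay
  for the loss of weight in the truncation error.\<close>

lemma truncated_solutions_Cauchy:
  assumes \<alpha>: "\<alpha>s < \<alpha>'" "\<alpha>' < \<alpha>" and x: "x \<in> E_space \<alpha>" and \<mu>: "4 * M \<alpha> < \<mu>"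
    and U0: "\<And>N. U N 0 = (\<lambda>n. if n < N then x n else 0)"
    and UE: "\<And>N \<beta> t. U N t \<in> E_space \<beta>"
    and U': "\<And>N \<beta> t. has_E_derivative \<beta> UNIV (U N) (restricted_generator {..<N} (U N t)) t"
    and t1: "0 \<le> t1" "\<mu> * t1 < \<alpha> - \<alpha>'"
  obtains \<eta> B where "\<eta> \<longlonglongrightarrow> 0"
    and "\<And>N N' t. N \<le> N' \<Longrightarrow> t \<in> {0..t1} \<Longrightarrow> E_norm \<alpha>' (\<lambda>n. U N t n - U N' t n) \<le> \<eta> N"
    and "\<And>N t. t \<in> {0..t1} \<Longrightarrow> E_norm \<alpha>' (U N t) \<le> B"
proof -
  have M\<alpha>: "0 < M \<alpha>" using M_pos \<alpha> by simp
  have \<mu>0: "0 < \<mu>" using M\<alpha> \<mu> by simp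
  define X where "X = E_norm \<alpha> x"
  define Y where "Y = X / (1 - 4 * M \<alpha> / \<mu>)"
  have X0: "0 \<le> X" unfolding X_def by (rule E_norm_nonneg[OF x])
  have \<kappa>: "0 < 1 - 4 * M \<alpha> / \<mu>" using \<mu> \<mu>0 by simp
  have Y0: "0 \<le> Y" unfolding Y_def using X0 \<kappa> by simp
  have bdd: "\<exists>K. \<forall>r\<in>{0..t}. E_norm \<beta> (U N r) \<le> K" for \<beta> N t
  proof -
    have "E_continuous_on \<beta> UNIV (U N)"
      by (rule has_E_derivative_imp_E_continuous_on[OF U'])
    then obtain K where "\<And>r. r \<in> {0..t} \<Longrightarrow> E_norm \<beta> (U N r) \<le> K"
      by (rule E_continuous_on_bounded[OF _ subset_UNIV]) (rule that)
    then show ?thesis by blast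
  qed
  have tail: "E_norm \<beta> (\<lambda>n. U N 0 n - U N' 0 n) \<le> exp (- \<nu> * real N) * X"
    if "\<beta> + \<nu> \<le> \<alpha>" "0 \<le> \<nu>" "N \<le> N'" for \<beta> \<nu> N N'
    unfolding X_def
  proof (rule E_norm_dominated(2)[OF x])
    fix n
    show "cmod (U N 0 n - U N' 0 n) * exp (\<beta> * real n)
        \<le> exp (- \<nu> * real N) * (cmod (x n) * exp (\<alpha> * real n))"
    proof (cases "n < N")
      case True
      then show ?thesis using that(3) by (simp add: U0)
    next
      case False
      have "\<nu> * real N \<le> \<nu> * real n" using that(2) False by (intro mult_left_mono) auto
      moreover have "(\<beta> + \<nu>) * real n \<le> \<alpha> * real n" using that(1) by (intro mult_right_mono) auto
      ultimately have "\<beta> * real n \<le> - \<nu> * real N + \<alpha> * real n" by (simp add: algebra_simps)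
      then have "exp (\<beta> * real n) \<le> exp (- \<nu> * real N) * exp (\<alpha> * real n)"
        by (simp only: exp_add[symmetric] exp_le_cancel_iff)
      moreover have "cmod (U N 0 n - U N' 0 n) \<le> cmod (x n)" by (simp add: U0)
      ultimately have "cmod (U N 0 n - U N' 0 n) * exp (\<beta> * real n)
          \<le> cmod (x n) * (exp (- \<nu> * real N) * exp (\<alpha> * real n))"
        by (intro mult_mono) auto
      then show ?thesis by (simp only: mult_ac)
    qed
  qed simp
  have UX: "E_norm \<alpha> (U N 0) \<le> X" for N
    using E_norm_dominated(2)[OF x, of "U N 0" \<alpha> 1] unfolding X_def by (simp add: U0)
  have bound: "E_norm \<beta> (U N t) * (\<alpha> - \<beta> - \<mu> * t) \<le> Y * (\<alpha> - \<beta>)"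
    if \<beta>: "\<alpha>s < \<beta>" "\<beta> < \<alpha>" and t: "0 \<le> t" "\<mu> * t < \<alpha> - \<beta>" for \<beta> N t
  proof -
    interpret R: weighted_system d "restrict_matrix {..<N} b" "restrict_matrix {..<N} c" \<alpha>s M
      by (rule weighted_system_restrict)
    obtain K where K: "\<And>r. r \<in> {0..t} \<Longrightarrow> E_norm \<alpha> (U N r) \<le> K"
      using bdd[of t \<alpha> N] by blast
    have zero: "(\<lambda>_. 0) \<in> E_space \<gamma>" "E_norm \<gamma> (\<lambda>_. 0) \<le> 0" for \<gamma>
      by (auto simp: E_space_def E_norm_def)
    have "E_norm \<beta> (U N t) * (\<alpha> - \<beta> - \<mu> * (t - 0))
        \<le> (X + 0 * (t - 0)) / (1 - 4 * M \<alpha> / \<mu>) * (\<alpha> - \<beta>)"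
    proof (rule R.a_priori_bound[where I=UNIV and g="\<lambda>_ _. 0" and K=K and w="U N" and t=t])
      show "M \<gamma> \<le> M \<alpha>" if "\<alpha>s < \<gamma>" "\<gamma> < \<alpha>" for \<gamma>
        using that by (intro M_mono) auto
      show "has_E_derivative \<gamma> UNIV (U N) (\<lambda>n. restricted_generator {..<N} (U N r) n + 0) r" for \<gamma> r
        using U' by simp
    qed (use t in \<open>simp_all add: \<mu> M\<alpha> \<beta> K UX UE zero\<close>)
    then show ?thesis by (simp add: Y_def)
  qed
  define \<alpha>t where "\<alpha>t = (\<alpha> + \<alpha>' + \<mu> * t1) / 2"
  \<comment> \<open>Three such losses leave half of the gap between \<open>\<alpha>t\<close> and \<open>\<alpha>\<close> as room for the uniform bound.\<close>
  define \<nu> where "\<nu> = (\<alpha> - \<alpha>t) / 6"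
  have \<mu>t1: "0 \<le> \<mu> * t1" using \<mu>0 t1 by simp
  have \<alpha>t: "\<alpha>t < \<alpha>" "\<alpha>' < \<alpha>t" "\<mu> * t1 < \<alpha>t - \<alpha>'"
    using t1 \<alpha> \<mu>t1 unfolding \<alpha>t_def by (auto simp: field_simps)
  have \<nu>: "0 < \<nu>" "\<alpha>t + 6 * \<nu> = \<alpha>" using \<alpha>t by (simp_all add: \<nu>_def field_simps)
  obtain C where C: "0 \<le> C" "\<And>\<beta> S S' N u. \<alpha>s < \<beta> \<Longrightarrow> \<beta> + 3 * \<nu> \<le> \<alpha> \<Longrightarrow>
      {..<N} \<subseteq> S \<Longrightarrow> {..<N} \<subseteq> S' \<Longrightarrow> u \<in> E_space (\<beta> + 3 * \<nu>) \<Longrightarrow>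
      (\<lambda>n. restricted_generator S u n - restricted_generator S' u n) \<in> E_space \<beta> \<and>
      E_norm \<beta> (\<lambda>n. restricted_generator S u n - restricted_generator S' u n)
        \<le> C * exp (- \<nu> * real N) * E_norm (\<beta> + 3 * \<nu>) u"
    by (rule restricted_generator_close[OF \<nu>(1), of \<alpha>]) (rule that)
  define G where "G = C * (Y * (\<alpha> - \<alpha>s) / (3 * \<nu>))"
  define \<rho> where "\<rho> = \<alpha>t - \<alpha>' - \<mu> * t1"
  have G0: "0 \<le> G" unfolding G_def using C(1) Y0 \<alpha> \<nu>(1) by simp
  have \<rho>0: "0 < \<rho>" unfolding \<rho>_def using \<alpha>t by simp
  define H where "H = (X + G * t1) / (1 - 4 * M \<alpha> / \<mu>) * (\<alpha>t - \<alpha>') / \<rho>"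
  have diff: "E_norm \<alpha>' (\<lambda>n. U N t n - U N' t n) \<le> H * exp (- \<nu> * real N)"
    if N: "N \<le> N'" and t: "t \<in> {0..t1}" for N N' t
  proof -
    interpret R: weighted_system d "restrict_matrix {..<N} b" "restrict_matrix {..<N} c" \<alpha>s M
      by (rule weighted_system_restrict)
    define g where "g r n = restricted_generator {..<N} (U N' r) n
      - restricted_generator {..<N'} (U N' r) n" for r n
    obtain K1 where K1: "\<And>r. r \<in> {0..t1} \<Longrightarrow> E_norm \<alpha>t (U N r) \<le> K1"
      using bdd[of t1 \<alpha>t N] by blast
    obtain K2 where K2: "\<And>r. r \<in> {0..t1} \<Longrightarrow> E_norm \<alpha>t (U N' r) \<le> K2"
      using bdd[of t1 \<alpha>t N'] by blast
    have "E_norm \<alpha>' (\<lambda>n. U N t n - U N' t n) * (\<alpha>t - \<alpha>' - \<mu> * (t - 0))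
        \<le> (exp (- \<nu> * real N) * X + exp (- \<nu> * real N) * G * (t1 - 0))
          / (1 - 4 * M \<alpha> / \<mu>) * (\<alpha>t - \<alpha>')"
    proof (rule R.a_priori_bound[where I=UNIV and g=g and K="K1 + K2" and \<alpha>=\<alpha>t
          and w="\<lambda>t n. U N t n - U N' t n" and t=t])
      show "M \<beta> \<le> M \<alpha>" if "\<alpha>s < \<beta>" "\<beta> < \<alpha>t" for \<beta>
        using that \<alpha>t by (intro M_mono) auto
      show "(\<lambda>n. U N r n - U N' r n) \<in> E_space \<alpha>t" for r
        by (intro E_norm_diff UE)
      show "E_norm \<alpha>t (\<lambda>n. U N r n - U N' r n) \<le> K1 + K2" if "r \<in> {0..t1}" for r
        using E_norm_diff(2)[OF UE UE, of \<alpha>t N r N' r] K1[OF that] K2[OF that] by simp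
      show "E_norm \<alpha>t (\<lambda>n. U N 0 n - U N' 0 n) \<le> exp (- \<nu> * real N) * X"
        using \<nu> N by (intro tail) auto
      show "0 \<le> exp (- \<nu> * real N) * G" using G0 by simp
      show "g r \<in> E_space \<beta> \<and> E_norm \<beta> (g r) \<le> exp (- \<nu> * real N) * G"
        if \<beta>: "\<alpha>s < \<beta>" "\<beta> < \<alpha>t" and r: "r \<in> {0..t1}" "\<mu> * (r - 0) < \<alpha>t - \<beta>" for \<beta> r
      proof -
        have \<beta>': "\<alpha>s < \<beta> + 3 * \<nu>" "\<beta> + 3 * \<nu> < \<alpha>" "\<mu> * r < \<alpha> - (\<beta> + 3 * \<nu>)" using \<beta> \<nu> r by auto
        have "E_norm (\<beta> + 3 * \<nu>) (U N' r) * (3 * \<nu>)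
            \<le> E_norm (\<beta> + 3 * \<nu>) (U N' r) * (\<alpha> - (\<beta> + 3 * \<nu>) - \<mu> * r)"
          using r \<nu> by (intro mult_left_mono E_norm_nonneg UE) auto
        also have "\<dots> \<le> Y * (\<alpha> - (\<beta> + 3 * \<nu>))"
          using \<beta>' r by (intro bound) auto
        also have "\<dots> \<le> Y * (\<alpha> - \<alpha>s)"
          using \<beta> \<nu> by (intro mult_left_mono Y0) auto
        finally have le: "E_norm (\<beta> + 3 * \<nu>) (U N' r) \<le> Y * (\<alpha> - \<alpha>s) / (3 * \<nu>)"
          using \<nu>(1) by (simp add: pos_le_divide_eq)
        have "g r \<in> E_space \<beta> \<and>
            E_norm \<beta> (g r) \<le> C * exp (- \<nu> * real N) * E_norm (\<beta> + 3 * \<nu>) (U N' r)"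
          unfolding g_def[abs_def] using \<beta> \<beta>' N UE by (intro C(2)) auto
        moreover have "C * exp (- \<nu> * real N) * E_norm (\<beta> + 3 * \<nu>) (U N' r)
            \<le> C * exp (- \<nu> * real N) * (Y * (\<alpha> - \<alpha>s) / (3 * \<nu>))"
          using C(1) by (intro mult_left_mono le) auto
        ultimately show ?thesis by (simp add: G_def mult_ac)
      qed
      show "has_E_derivative \<beta> UNIV (\<lambda>t n. U N t n - U N' t n)
          (\<lambda>n. restricted_generator {..<N} (\<lambda>n. U N r n - U N' r n) n + g r n) r"
        if "\<alpha>s < \<beta>" for \<beta> r
      proof -
        have "(\<lambda>n. restricted_generator {..<N} (\<lambda>n. U N r n - U N' r n) n + g r n)
            = (\<lambda>n. restricted_generator {..<N} (U N r) n - restricted_generator {..<N'} (U N' r) n)"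
          using R.generator_diff[OF that UE UE] by (simp add: g_def)
        then show ?thesis using has_E_derivative_diff[OF U' U' UNIV_I] by metis
      qed
      have "\<mu> * t \<le> \<mu> * t1" using t \<mu>0 by simp
      then show "\<mu> * (t - 0) < \<alpha>t - \<alpha>'" using \<alpha>t by simp
    qed (use t t1 in \<open>simp_all add: \<mu> M\<alpha> \<alpha> \<alpha>t\<close>)
    also have "\<dots> = H * exp (- \<nu> * real N) * \<rho>"
    proof -
      have H: "H * \<rho> = (X + G * t1) / (1 - 4 * M \<alpha> / \<mu>) * (\<alpha>t - \<alpha>')"
        using \<rho>0 by (simp add: H_def)
      have factor: "exp (- \<nu> * real N) * X + exp (- \<nu> * real N) * G * (t1 - 0)
          = exp (- \<nu> * real N) * (X + G * t1)" by (simp add: distrib_left)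
      have "H * exp (- \<nu> * real N) * \<rho> = exp (- \<nu> * real N) * (H * \<rho>)" by simp
      then show ?thesis unfolding factor H by simp
    qed
    finally have le: "E_norm \<alpha>' (\<lambda>n. U N t n - U N' t n) * (\<alpha>t - \<alpha>' - \<mu> * t)
        \<le> H * exp (- \<nu> * real N) * \<rho>" by simp
    have "E_norm \<alpha>' (\<lambda>n. U N t n - U N' t n) * \<rho>
        \<le> E_norm \<alpha>' (\<lambda>n. U N t n - U N' t n) * (\<alpha>t - \<alpha>' - \<mu> * t)"
    proof (intro mult_left_mono E_norm_nonneg E_norm_diff UE)
      show "\<rho> \<le> \<alpha>t - \<alpha>' - \<mu> * t"
        using t \<mu>0 by (simp add: \<rho>_def mult_left_mono)
    qed
    then show ?thesis using le \<rho>0 by (meson mult_le_cancel_right_pos order_trans)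
  qed
  have ub: "E_norm \<alpha>' (U N t) \<le> Y * (\<alpha> - \<alpha>') / (\<alpha> - \<alpha>' - \<mu> * t1)" if t: "t \<in> {0..t1}" for N t
  proof -
    have le: "\<mu> * t \<le> \<mu> * t1" using t \<mu>0 by simp
    have "E_norm \<alpha>' (U N t) * (\<alpha> - \<alpha>' - \<mu> * t1) \<le> E_norm \<alpha>' (U N t) * (\<alpha> - \<alpha>' - \<mu> * t)"
      using le by (intro mult_left_mono E_norm_nonneg UE) auto
    also have "\<dots> \<le> Y * (\<alpha> - \<alpha>')"
      using le t1 t \<alpha> by (intro bound) auto
    finally show ?thesis using t1 by (simp add: pos_le_divide_eq)
  qed
  have "(\<lambda>N. H * exp (- \<nu> * real N)) \<longlonglongrightarrow> 0"
    by (rule tendsto_mult_right_zero[OF exp_decay[OF \<nu>(1)]])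
  then show thesis using diff ub by (rule that)
qed

text \<open>Everything is proved on \<open>{0..<t1}\<close> with \<open>t1 < T\<close>, where convergence of the truncated solutions
  is uniform, and transferred to \<open>{0..<T}\<close> because the two sets agree near each time below \<open>t1\<close>.\<close>

lemma solution_exists:
  assumes \<alpha>: "\<alpha>s < \<alpha>'" "\<alpha>' < \<alpha>" and x: "x \<in> E_space \<alpha>" and \<mu>: "4 * M \<alpha> < \<mu>"
    and T: "T = (\<alpha> - \<alpha>') / \<mu>"
  obtains u where "E_continuous_on \<alpha>' {0..<T} u" and "u 0 = x"
    and "\<And>\<beta>. \<alpha>s < \<beta> \<Longrightarrow> \<beta> < \<alpha>' \<Longrightarrow> E_continuous_on \<beta> {0..<T} (\<lambda>t. generator (u t))"
    and "\<And>\<beta> t. \<alpha>s < \<beta> \<Longrightarrow> \<beta> < \<alpha>' \<Longrightarrow> t \<in> {0..<T} \<Longrightarrow>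
      has_E_derivative \<beta> {0..<T} u (generator (u t)) t"
proof -
  have \<mu>0: "0 < \<mu>" using M_pos[of \<alpha>] \<alpha> \<mu> by simp
  define P where "P N U \<longleftrightarrow> U 0 = (\<lambda>n. if n < N then x n else 0) \<and> (\<forall>\<beta> t. U t \<in> E_space \<beta>) \<and>
      (\<forall>\<beta> t. has_E_derivative \<beta> UNIV U (restricted_generator {..<N} (U t)) t) \<and>
      (\<forall>n t. ((\<lambda>s. U s n) has_vector_derivative restricted_generator {..<N} (U t) n) (at t))"
    for N and U :: "real \<Rightarrow> nat \<Rightarrow> complex"
  have "\<exists>U. P N U" for N
    unfolding P_def by (rule truncated_solution[of N x]) (intro exI conjI allI; assumption)
  then obtain U where "\<And>N. P N (U N)"
    using choice[of P] by blast
  then have U: "\<And>N. U N 0 = (\<lambda>n. if n < N then x n else 0)"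
    "\<And>N \<beta> t. U N t \<in> E_space \<beta>"
    "\<And>N \<beta> t. has_E_derivative \<beta> UNIV (U N) (restricted_generator {..<N} (U N t)) t"
    "\<And>N n t. ((\<lambda>s. U N s n) has_vector_derivative restricted_generator {..<N} (U N t) n) (at t)"
    unfolding P_def by auto
  note loc = truncated_solutions_Cauchy[OF \<alpha> x \<mu> U(1-3)]
  define u where "u t n = lim (\<lambda>N. U N t n)" for t n
  have lim: "\<exists>\<eta> B. \<eta> \<longlonglongrightarrow> 0 \<and> (\<forall>t\<in>{0..t1}. u t \<in> E_space \<alpha>' \<and> (\<forall>n. (\<lambda>N. U N t n) \<longlonglongrightarrow> u t n) \<and>
      (\<forall>N. E_norm \<alpha>' (\<lambda>n. U N t n - u t n) \<le> \<eta> N \<and> E_norm \<alpha>' (U N t) \<le> B))"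
    if t1: "0 \<le> t1" "t1 < T" for t1
  proof -
    have "\<mu> * t1 < \<alpha> - \<alpha>'" using t1 \<mu>0 by (simp add: T pos_less_divide_eq mult.commute)
    then obtain \<eta> B where \<eta>: "\<eta> \<longlonglongrightarrow> 0"
      "\<And>N N' t. N \<le> N' \<Longrightarrow> t \<in> {0..t1} \<Longrightarrow> E_norm \<alpha>' (\<lambda>n. U N t n - U N' t n) \<le> \<eta> N"
      "\<And>N t. t \<in> {0..t1} \<Longrightarrow> E_norm \<alpha>' (U N t) \<le> B"
      by (rule loc[OF t1(1)]) (rule that)
    have "u t \<in> E_space \<alpha>' \<and> (\<forall>n. (\<lambda>N. U N t n) \<longlonglongrightarrow> u t n) \<and>
      (\<forall>N. E_norm \<alpha>' (\<lambda>n. U N t n - u t n) \<le> \<eta> N \<and> E_norm \<alpha>' (U N t) \<le> B)"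
      if t: "t \<in> {0..t1}" for t
      unfolding u_def[abs_def]
      by (intro conjI allI \<eta>(3)[OF t]
          E_Cauchy_limit[where f="\<lambda>N. U N t" and \<alpha>=\<alpha>' and \<eta>=\<eta>, OF U(2) \<eta>(2)[OF _ t] \<eta>(1)])
    then show ?thesis using \<eta>(1) by blast
  qed
  have uE: "u t \<in> E_space \<alpha>'" "(\<lambda>N. U N t n) \<longlonglongrightarrow> u t n" if "t \<in> {0..<T}" for t n
    using lim[of t] that by auto
  have T0: "0 < T" using \<alpha> \<mu>0 by (simp add: T)
  have u0: "u 0 = x"
  proof
    fix n
    have "(\<lambda>N. U N 0 n) \<longlonglongrightarrow> x n"
      by (rule tendsto_eventually)
        (auto simp: U(1) eventually_sequentially intro!: exI[of _ "Suc n"])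
    moreover have "(\<lambda>N. U N 0 n) \<longlonglongrightarrow> u 0 n" using uE(2)[of 0] T0 by simp
    ultimately show "u 0 n = x n" by (rule LIMSEQ_unique[symmetric])
  qed
  have filter_eq: "at t within {0..<t1} = at t within {0..<T}" if "t < t1" "t1 < T" for t t1
    using that by (intro at_within_nhd[of t "{..<t1}"]) auto
  have cont: "E_continuous_on \<alpha>' {0..<T} u"
    unfolding E_continuous_on_def
  proof (intro conjI ballI uE)
    fix t assume t: "t \<in> {0..<T}"
    define t1 where "t1 = (t + T) / 2"
    have t1: "0 \<le> t1" "t < t1" "t1 < T" using t by (auto simp: t1_def)
    obtain \<eta> B where \<eta>: "\<eta> \<longlonglongrightarrow> 0"
      "\<forall>t\<in>{0..t1}. u t \<in> E_space \<alpha>' \<and> (\<forall>n. (\<lambda>N. U N t n) \<longlonglongrightarrow> u t n) \<and>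
      (\<forall>N. E_norm \<alpha>' (\<lambda>n. U N t n - u t n) \<le> \<eta> N \<and> E_norm \<alpha>' (U N t) \<le> B)"
      using lim[OF t1(1,3)] by blast
    have UC: "E_continuous_on \<alpha>' {0..<t1} (U N)" for N
      using has_E_derivative_imp_E_continuous_on[OF U(3), of \<alpha>' N]
      by (auto simp: E_continuous_on_def intro: tendsto_within_subset)
    have "E_continuous_on \<alpha>' {0..<t1} u"
      by (rule E_continuous_uniform_limit[OF UC _ _ \<eta>(1)]) (use \<eta>(2) in auto)
    then show "((\<lambda>s. E_norm \<alpha>' (\<lambda>n. u s n - u t n)) \<longlongrightarrow> 0) (at t within {0..<T})"
      using t t1 by (simp add: E_continuous_on_def filter_eq)
  qed
  have gen_cont: "E_continuous_on \<beta> {0..<T} (\<lambda>t. generator (u t))" if \<beta>: "\<alpha>s < \<beta>" "\<beta> < \<alpha>'" for \<beta>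
  proof -
    obtain K where K: "0 \<le> K" "\<And>u. u \<in> E_space \<alpha>' \<Longrightarrow> generator u \<in> E_space \<beta>"
      "\<And>u. u \<in> E_space \<alpha>' \<Longrightarrow> E_norm \<beta> (generator u) \<le> K * E_norm \<alpha>' u"
      by (rule generator_bounded[OF \<beta>]) (rule that)
    have "((\<lambda>s. E_norm \<beta> (\<lambda>n. generator (u s) n - generator (u t) n)) \<longlongrightarrow> 0) (at t within {0..<T})"
      if t: "t \<in> {0..<T}" for t
    proof (rule Lim_null_comparison)
      show "((\<lambda>s. K * E_norm \<alpha>' (\<lambda>n. u s n - u t n)) \<longlongrightarrow> 0) (at t within {0..<T})"
        using cont t by (intro tendsto_mult_right_zero) (simp add: E_continuous_on_def)
      have "norm (E_norm \<beta> (\<lambda>n. generator (u s) n - generator (u t) n))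
          \<le> K * E_norm \<alpha>' (\<lambda>n. u s n - u t n)" if s: "s \<in> {0..<T}" for s
      proof -
        have "0 \<le> E_norm \<beta> (\<lambda>n. generator (u s) n - generator (u t) n)"
          by (intro E_norm_nonneg E_norm_diff K uE s t)
        moreover have "generator (\<lambda>n. u s n - u t n) = (\<lambda>n. generator (u s) n - generator (u t) n)"
          by (intro ext generator_diff[OF \<alpha>(1) uE(1)[OF s] uE(1)[OF t]])
        ultimately show ?thesis
          using K(3)[OF E_norm_diff(1)[OF uE(1)[OF s] uE(1)[OF t]]] by simp
      qed
      then show "\<forall>\<^sub>F s in at t within {0..<T}.
          norm (E_norm \<beta> (\<lambda>n. generator (u s) n - generator (u t) n))
          \<le> K * E_norm \<alpha>' (\<lambda>n. u s n - u t n)"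
        unfolding eventually_at_filter by (intro always_eventually) blast
    qed
    then show ?thesis using K uE by (auto simp: E_continuous_on_def)
  qed
  have coord: "((\<lambda>r. u r n) has_vector_derivative generator (u t) n) (at t within {0..<T})"
    if t: "t \<in> {0..<T}" for n t
  proof -
    define t1 where "t1 = (t + T) / 2"
    have t1: "0 \<le> t1" "t < t1" "t1 < T" using t by (auto simp: t1_def)
    obtain \<eta> B where \<eta>: "\<eta> \<longlonglongrightarrow> 0"
      "\<forall>t\<in>{0..t1}. u t \<in> E_space \<alpha>' \<and> (\<forall>n. (\<lambda>N. U N t n) \<longlonglongrightarrow> u t n) \<and>
      (\<forall>N. E_norm \<alpha>' (\<lambda>n. U N t n - u t n) \<le> \<eta> N \<and> E_norm \<alpha>' (U N t) \<le> B)"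
      using lim[OF t1(1,3)] by blast
    define \<nu> where "\<nu> = (\<alpha>' - \<alpha>s) / 6"
    define \<beta> where "\<beta> = (\<alpha>' + \<alpha>s) / 2"
    have \<nu>: "0 < \<nu>" "\<beta> + 3 * \<nu> = \<alpha>'" and \<beta>: "\<alpha>s < \<beta>" "\<beta> < \<alpha>'"
      using \<alpha> by (auto simp: \<nu>_def \<beta>_def field_simps)
    obtain C where C: "0 \<le> C" "\<And>\<beta> S S' N u. \<alpha>s < \<beta> \<Longrightarrow> \<beta> + 3 * \<nu> \<le> \<alpha>' \<Longrightarrow>
        {..<N} \<subseteq> S \<Longrightarrow> {..<N} \<subseteq> S' \<Longrightarrow> u \<in> E_space (\<beta> + 3 * \<nu>) \<Longrightarrow>
        (\<lambda>n. restricted_generator S u n - restricted_generator S' u n) \<in> E_space \<beta> \<and>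
        E_norm \<beta> (\<lambda>n. restricted_generator S u n - restricted_generator S' u n)
          \<le> C * exp (- \<nu> * real N) * E_norm (\<beta> + 3 * \<nu>) u"
      by (rule restricted_generator_close[OF \<nu>(1), of \<alpha>']) (rule that)
    obtain K where K: "0 \<le> K" "\<And>u. u \<in> E_space \<alpha>' \<Longrightarrow> generator u \<in> E_space \<beta>"
      "\<And>u. u \<in> E_space \<alpha>' \<Longrightarrow> E_norm \<beta> (generator u) \<le> K * E_norm \<alpha>' u"
      by (rule generator_bounded[OF \<beta>]) (rule that)
    define \<zeta> where "\<zeta> N = (C * exp (- \<nu> * real N) * B + K * \<eta> N) * exp (- (\<beta> * real n))" for N
    note exp0 = exp_decay[OF \<nu>(1)]
    have "\<zeta> \<longlonglongrightarrow> (C * 0 * B + K * 0) * exp (- (\<beta> * real n))"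
      unfolding \<zeta>_def by (intro tendsto_intros exp0 \<eta>(1))
    then have \<zeta>: "\<zeta> \<longlonglongrightarrow> 0" by simp
    have close: "cmod (restricted_generator {..<N} (U N r) n - generator (u r) n) \<le> \<zeta> N"
      if r: "r \<in> {0..<t1}" for N r
    proof -
      have r': "r \<in> {0..t1}" using r by auto
      have ur: "u r \<in> E_space \<alpha>'" and U_le: "E_norm \<alpha>' (\<lambda>n. U N r n - u r n) \<le> \<eta> N"
        and UB: "E_norm \<alpha>' (U N r) \<le> B"
        using \<eta>(2) r' by blast+
      have "(\<lambda>n. restricted_generator {..<N} (U N r) n - restricted_generator UNIV (U N r) n) \<in> E_space \<beta> \<and>
          E_norm \<beta> (\<lambda>n. restricted_generator {..<N} (U N r) n - restricted_generator UNIV (U N r) n)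
          \<le> C * exp (- \<nu> * real N) * E_norm (\<beta> + 3 * \<nu>) (U N r)"
        using \<beta> \<nu> U(2) by (intro C(2)) auto
      then have 1: "(\<lambda>n. restricted_generator {..<N} (U N r) n - generator (U N r) n) \<in> E_space \<beta>"
        "E_norm \<beta> (\<lambda>n. restricted_generator {..<N} (U N r) n - generator (U N r) n)
          \<le> C * exp (- \<nu> * real N) * E_norm \<alpha>' (U N r)"
        by (simp_all add: restrict_matrix_UNIV \<nu>(2))
      have 2: "(\<lambda>n. U N r n - u r n) \<in> E_space \<alpha>'" by (intro E_norm_diff U ur)
      have eq: "restricted_generator {..<N} (U N r) n - generator (u r) n
          = (restricted_generator {..<N} (U N r) n - generator (U N r) n)
            + generator (\<lambda>n. U N r n - u r n) n" for n
        using generator_diff[OF \<alpha>(1) U(2) ur] by simp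
      have "cmod (restricted_generator {..<N} (U N r) n - generator (u r) n) * exp (\<beta> * real n)
          \<le> E_norm \<beta> (\<lambda>n. (restricted_generator {..<N} (U N r) n - generator (U N r) n)
            + generator (\<lambda>n. U N r n - u r n) n)"
        unfolding eq by (rule coordinate_le_E_norm[OF E_norm_add(1)[OF 1(1) K(2)[OF 2]]])
      also have "\<dots> \<le> C * exp (- \<nu> * real N) * E_norm \<alpha>' (U N r)
          + K * E_norm \<alpha>' (\<lambda>n. U N r n - u r n)"
        by (rule order_trans[OF E_norm_add(2)[OF 1(1) K(2)[OF 2]] add_mono[OF 1(2) K(3)[OF 2]]])
      also have "\<dots> \<le> C * exp (- \<nu> * real N) * B + K * \<eta> N"
        using C(1) K(1) by (intro add_mono mult_left_mono UB U_le) auto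
      finally show ?thesis by (simp add: \<zeta>_def exp_minus field_simps)
    qed
    have "\<exists>g. \<forall>r\<in>{0..<t1}. (\<lambda>N. U N r n) \<longlonglongrightarrow> g r \<and>
        (g has_derivative (\<lambda>h. h *\<^sub>R generator (u r) n)) (at r within {0..<t1})"
    proof (rule has_derivative_sequence)
      show "convex {0..<t1}" by simp
      show "((\<lambda>r. U N r n) has_derivative (\<lambda>h. h *\<^sub>R restricted_generator {..<N} (U N r) n))
          (at r within {0..<t1})" for N r
        using has_vector_derivative_at_within[OF U(4)]
        by (simp add: has_vector_derivative_def)
      show "0 \<in> {0..<t1}" using t t1 by auto
      show "(\<lambda>N. U N 0 n) \<longlonglongrightarrow> u 0 n" using uE(2)[of 0] T0 by simp
      fix e :: real assume e: "0 < e"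
      have "\<forall>\<^sub>F N in sequentially. \<zeta> N < e" by (rule order_tendstoD(2)[OF \<zeta> e])
      then show "\<forall>\<^sub>F N in sequentially. \<forall>r\<in>{0..<t1}. \<forall>h. norm (h *\<^sub>R restricted_generator {..<N} (U N r) n
          - h *\<^sub>R generator (u r) n) \<le> e * norm h"
      proof eventually_elim
        case (elim N)
        show ?case
        proof (intro ballI allI)
          fix r h :: real assume r: "r \<in> {0..<t1}"
          have "norm (h *\<^sub>R restricted_generator {..<N} (U N r) n - h *\<^sub>R generator (u r) n)
              = \<bar>h\<bar> * cmod (restricted_generator {..<N} (U N r) n - generator (u r) n)"
            by (simp flip: scaleR_diff_right)
          also have "\<dots> \<le> \<bar>h\<bar> * e"
            using close[OF r, of N] elim by (intro mult_left_mono) auto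
          finally show "norm (h *\<^sub>R restricted_generator {..<N} (U N r) n
              - h *\<^sub>R generator (u r) n) \<le> e * norm h" by (simp add: mult.commute)
        qed
      qed
    qed
    then obtain g where g: "\<And>r. r \<in> {0..<t1} \<Longrightarrow> (\<lambda>N. U N r n) \<longlonglongrightarrow> g r"
      "\<And>r. r \<in> {0..<t1} \<Longrightarrow> (g has_vector_derivative generator (u r) n) (at r within {0..<t1})"
      unfolding has_vector_derivative_def by blast
    have gu: "g r = u r n" if "r \<in> {0..<t1}" for r
      using LIMSEQ_unique[OF g(1)[OF that] uE(2)[of r n]] that t1 by auto
    have tt: "t \<in> {0..<t1}" using t t1 by auto
    have "((\<lambda>r. u r n) has_vector_derivative generator (u t) n) (at t within {0..<t1})"
      by (rule has_vector_derivative_transform[OF tt _ g(2)[OF tt]]) (simp add: gu)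
    then show ?thesis
      unfolding has_vector_derivative_def using filter_eq[OF t1(2,3)] by simp
  qed
  show thesis
  proof (rule that[OF cont u0 gen_cont])
    show "has_E_derivative \<beta> {0..<T} u (generator (u t)) t"
      if "\<alpha>s < \<beta>" "\<beta> < \<alpha>'" "t \<in> {0..<T}" for \<beta> t
      using that
      by (intro has_E_derivative_coordinatewise[where v="\<lambda>t. generator (u t)"]
          gen_cont coord E_space_antimono[OF uE(1)]) auto
  qed
qed

end

section \<open>Uniqueness\<close>

context weighted_system
begin

text \<open>A single application of the a priori bound shows that the difference vanishes during a time
  \<open>\<delta>\<close> that does not depend on where the interval starts. Once the difference vanishes, it does so in the norm with index \<open>\<alpha>'\<close>
  again, so no weight is lost and the argument can be repeated until it covers the interval.\<close>

lemma solution_unique: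
  assumes \<alpha>': "\<alpha>s < \<alpha>'"
    and u: "E_continuous_on \<alpha>' {0..<T} u"
      "\<And>\<beta> t. \<alpha>s < \<beta> \<Longrightarrow> \<beta> < \<alpha>' \<Longrightarrow> t \<in> {0..<T} \<Longrightarrow>
        has_E_derivative \<beta> {0..<T} u (generator (u t)) t"
    and v: "E_continuous_on \<alpha>' {0..<T} v"
      "\<And>\<beta> t. \<alpha>s < \<beta> \<Longrightarrow> \<beta> < \<alpha>' \<Longrightarrow> t \<in> {0..<T} \<Longrightarrow>
        has_E_derivative \<beta> {0..<T} v (generator (v t)) t"
    and init: "u 0 = v 0" and t: "t \<in> {0..<T}"
  shows "u t = v t"
proof -
  define w where "w r n = u r n - v r n" for r n
  \<comment> \<open>Any factor above four makes the iteration contract; \<open>\<delta>\<close> uses up half of the room at \<open>\<beta>\<close>.\<close>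
  define \<mu> where "\<mu> = 5 * M \<alpha>'"
  define \<beta> where "\<beta> = (\<alpha>s + \<alpha>') / 2"
  define \<delta> where "\<delta> = (\<alpha>' - \<beta>) / (2 * \<mu>)"
  have M: "0 < M \<alpha>'" by (rule M_pos[OF \<alpha>'])
  have \<mu>: "0 < \<mu>" "4 * M \<alpha>' < \<mu>" using M by (auto simp: \<mu>_def)
  have \<beta>: "\<alpha>s < \<beta>" "\<beta> < \<alpha>'" using \<alpha>' by (auto simp: \<beta>_def)
  have \<delta>: "0 < \<delta>" using \<beta> \<mu> by (simp add: \<delta>_def)
  have uE: "u r \<in> E_space \<alpha>'" and vE: "v r \<in> E_space \<alpha>'" if "r \<in> {0..<T}" for r
    using u(1) v(1) that by (auto simp: E_continuous_on_def)
  have wE: "w r \<in> E_space \<alpha>'" if "r \<in> {0..<T}" for r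
    unfolding w_def[abs_def] using that by (intro E_norm_diff uE vE)
  have I: "{0..t} \<subseteq> {0..<T}" using t by auto
  obtain K1 where K1: "\<And>r. r \<in> {0..t} \<Longrightarrow> E_norm \<alpha>' (u r) \<le> K1"
    by (rule E_continuous_on_bounded[OF u(1) I]) (rule that)
  obtain K2 where K2: "\<And>r. r \<in> {0..t} \<Longrightarrow> E_norm \<alpha>' (v r) \<le> K2"
    by (rule E_continuous_on_bounded[OF v(1) I]) (rule that)
  have K: "E_norm \<alpha>' (w r) \<le> K1 + K2" if r: "r \<in> {0..t}" for r
  proof -
    have rT: "r \<in> {0..<T}" using r I by blast
    show ?thesis unfolding w_def[abs_def]
      by (rule order_trans[OF E_norm_diff(2)[OF uE[OF rT] vE[OF rT]] add_mono[OF K1[OF r] K2[OF r]]])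
  qed
  have deriv: "has_E_derivative \<gamma> {0..<T} w (\<lambda>n. generator (w r) n + 0) r"
    if \<gamma>: "\<alpha>s < \<gamma>" "\<gamma> < \<alpha>'" and r: "r \<in> {0..<T}" for \<gamma> r
  proof -
    have "(\<lambda>n. generator (w r) n + 0) = (\<lambda>n. generator (u r) n - generator (v r) n)"
      unfolding w_def[abs_def] using generator_diff[OF \<alpha>' uE[OF r] vE[OF r]] by simp
    then show ?thesis
      using has_E_derivative_diff[OF u(2)[OF \<gamma> r] v(2)[OF \<gamma> r] r] by (simp add: w_def[abs_def])
  qed
  have zero: "(\<lambda>_. 0) \<in> E_space \<gamma>" "E_norm \<gamma> (\<lambda>_. 0) \<le> 0" for \<gamma>
    by (auto simp: E_space_def E_norm_def)
  have step: "w r = (\<lambda>_. 0)"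
    if s: "w s = (\<lambda>_. 0)" "0 \<le> s" "s \<le> r" "r \<le> t" "r - s \<le> \<delta>" for s r
  proof -
    have "\<mu> * (r - s) \<le> \<mu> * \<delta>" using s \<mu> by (intro mult_left_mono) auto
    also have "\<mu> * \<delta> = (\<alpha>' - \<beta>) / 2" using \<mu> by (simp add: \<delta>_def)
    also have "\<dots> < \<alpha>' - \<beta>" using \<beta> by simp
    finally have room: "\<mu> * (r - s) < \<alpha>' - \<beta>" .
    have sub: "{s..t} \<subseteq> {0..<T}" using s t by auto
    have "E_norm \<beta> (w r) * (\<alpha>' - \<beta> - \<mu> * (r - s))
        \<le> (0 + 0 * (t - s)) / (1 - 4 * M \<alpha>' / \<mu>) * (\<alpha>' - \<beta>)"
    proof (rule a_priori_bound[where I="{0..<T}" and g="\<lambda>_ _. 0" and K="K1 + K2" and w=w and t=r])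
      show "E_norm \<alpha>' (w s) \<le> 0" unfolding s(1) by (rule zero)
      show "has_E_derivative \<gamma> {0..<T} w (\<lambda>n. generator (w q) n + 0) q"
        if "\<alpha>s < \<gamma>" "\<gamma> < \<alpha>'" "q \<in> {s..t}" for \<gamma> q
        using that sub by (intro deriv) auto
      show "M \<gamma> \<le> M \<alpha>'" if "\<alpha>s < \<gamma>" "\<gamma> < \<alpha>'" for \<gamma>
        using that by (intro M_mono) auto
      show "w q \<in> E_space \<alpha>'" if "q \<in> {s..t}" for q using that sub by (intro wE) auto
      show "E_norm \<alpha>' (w q) \<le> K1 + K2" if "q \<in> {s..t}" for q using that s by (intro K) auto
    qed (use s sub in \<open>simp_all add: \<mu> M \<beta> room zero\<close>)
    then have le: "E_norm \<beta> (w r) * (\<alpha>' - \<beta> - \<mu> * (r - s)) \<le> 0" by simp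
    have "w r \<in> E_space \<beta>" using s t \<beta> by (intro E_space_antimono[OF wE]) auto
    moreover have "E_norm \<beta> (w r) \<le> 0"
      using le room by (simp add: mult_le_0_iff)
    ultimately show ?thesis by (intro ext E_norm_eq_0D)
  qed
  have "\<forall>r\<in>{0..t}. r \<le> real j * \<delta> \<longrightarrow> w r = (\<lambda>_. 0)" for j
  proof (induction j)
    case 0
    show ?case using init by (auto simp: w_def[abs_def])
  next
    case (Suc j)
    show ?case
    proof (intro ballI impI)
      fix r assume r: "r \<in> {0..t}" "r \<le> real (Suc j) * \<delta>"
      show "w r = (\<lambda>_. 0)"
      proof (cases "r \<le> real j * \<delta>")
        case True
        then show ?thesis using Suc.IH r by blast
      next
        case False
        have s: "0 \<le> real j * \<delta>" "real j * \<delta> \<le> r" "r - real j * \<delta> \<le> \<delta>"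
          using False \<delta> r by (auto simp: algebra_simps)
        have "w (real j * \<delta>) = (\<lambda>_. 0)" using Suc.IH s r by auto
        then show ?thesis by (rule step) (use s r in auto)
      qed
    qed
  qed
  moreover obtain j :: nat where "t / \<delta> \<le> real j" using real_arch_simple by blast
  then have "t \<le> real j * \<delta>" using \<delta> by (simp add: pos_divide_le_eq)
  ultimately have "w t = (\<lambda>_. 0)" using t by auto
  then show ?thesis by (simp add: w_def[abs_def] fun_eq_iff)
qed

end

section \<open>The infinite system\<close>

theorem theorem4p2:
  fixes a b c :: "nat \<Rightarrow> nat \<Rightarrow> complex"
    and d :: "nat \<Rightarrow> real"
    and \<alpha>star :: real
    and q M :: "real \<Rightarrow> real"
  assumes E1: "\<forall>n. d n > 0"
      "\<forall>n k. a n k = - (if n = k then of_real (d n) else 0) + b n k + c n k"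
    and E2: "\<forall>\<alpha>>\<alpha>star. 0 < q \<alpha> \<and> q \<alpha> < 1"
      "\<forall>\<alpha>>\<alpha>star. \<forall>k. summable (\<lambda>n. cmod (b n k) * exp (\<alpha> * real n)) \<and>
         exp (- \<alpha> * real k) * (\<Sum>n. cmod (b n k) * exp (\<alpha> * real n)) \<le> q \<alpha> * d k"
    and E3: "\<forall>\<nu>>0. bdd_above ((\<lambda>n. d n * exp (- \<nu> * real n)) ` {1..})"
    and E4: "continuous_on {\<alpha>star<..} M" "mono_on {\<alpha>star<..} M" "\<forall>\<alpha>>\<alpha>star. M \<alpha> > 0"
      "\<forall>\<alpha> \<alpha>'. \<alpha>star < \<alpha>' \<and> \<alpha>' < \<alpha> \<longrightarrow>
         (\<forall>k. summable (\<lambda>n. cmod (c n k) * exp (\<alpha>' * real n)) \<and>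
           exp (- \<alpha> * real k) * (\<Sum>n. cmod (c n k) * exp (\<alpha>' * real n)) \<le> M \<alpha> / (\<alpha> - \<alpha>'))"
  shows "\<forall>\<alpha> \<alpha>' x. \<alpha>star < \<alpha>' \<and> \<alpha>' < \<alpha> \<and> x \<in> E_space \<alpha> \<longrightarrow>
    (let T = (\<alpha> - \<alpha>') / (2 * exp 1 * M \<alpha>) in
      \<exists>u. classical_solution \<alpha>star a \<alpha>' T x u \<and>
        (\<forall>v. classical_solution \<alpha>star a \<alpha>' T x v \<longrightarrow> (\<forall>t\<in>{0..<T}. v t = u t)))"
proof (intro allI impI)
  have column: "(\<Sum>n<m. cmod (A n k) * exp (\<beta> * real n)) \<le> B * exp (\<gamma> * real k)"
    if "summable (\<lambda>n. cmod (A n k) * exp (\<beta> * real n))"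
      "exp (- \<gamma> * real k) * (\<Sum>n. cmod (A n k) * exp (\<beta> * real n)) \<le> B"
    for A :: "nat \<Rightarrow> nat \<Rightarrow> complex" and \<beta> \<gamma> B k m
  proof -
    have "(\<Sum>n<m. cmod (A n k) * exp (\<beta> * real n)) \<le> (\<Sum>n. cmod (A n k) * exp (\<beta> * real n))"
      by (intro sum_le_suminf that) auto
    also have "\<dots> \<le> B * exp (\<gamma> * real k)"
      using that(2) by (simp add: exp_minus field_simps)
    finally show ?thesis .
  qed
  interpret weighted_system d b c \<alpha>star M
  proof
    show "0 \<le> d n" for n using E1(1) by (simp add: less_imp_le)
    show "\<exists>K. \<forall>n. d n \<le> K * exp (\<nu> * real n)" if "0 < \<nu>" for \<nu>
    proof -
      have "bdd_above ((\<lambda>n. d n * exp (- \<nu> * real n)) ` {1..})"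
        using that by (rule E3[rule_format])
      then obtain K where "\<forall>n\<in>{1..}. d n * exp (- \<nu> * real n) \<le> K"
        by (auto simp: bdd_above_def)
      then have "d n * exp (- \<nu> * real n) \<le> max K (d 0)" for n
        by (cases "n = 0") (auto simp: le_max_iff_disj)
      then have "d n \<le> max K (d 0) * exp (\<nu> * real n)" for n
        by (simp add: exp_minus field_simps)
      then show ?thesis by blast
    qed
    show "(\<Sum>n<m. cmod (b n k) * exp (\<beta> * real n)) \<le> d k * exp (\<beta> * real k)"
      if "\<alpha>star < \<beta>" for \<beta> m k
    proof (rule column)
      have "q \<beta> * d k \<le> 1 * d k"
        using E1(1) E2(1) that by (intro mult_right_mono) (auto simp: less_imp_le)
      then show "exp (- \<beta> * real k) * (\<Sum>n. cmod (b n k) * exp (\<beta> * real n)) \<le> d k"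
        using E2(2)[rule_format, OF that, of k] by simp
    qed (use E2(2) that in blast)
    show "(\<Sum>n<m. cmod (c n k) * exp (\<beta> * real n)) \<le> M \<gamma> / (\<gamma> - \<beta>) * exp (\<gamma> * real k)"
      if "\<alpha>star < \<beta>" "\<beta> < \<gamma>" for \<beta> \<gamma> m k
      by (rule column) (use E4(4) that in blast)+
    show "0 < M \<beta>" if "\<alpha>star < \<beta>" for \<beta> using E4(3) that by blast
    show "M \<beta> \<le> M \<gamma>" if "\<alpha>star < \<beta>" "\<beta> \<le> \<gamma>" for \<beta> \<gamma>
      using E4(2) that by (auto intro: mono_onD)
  qed
  fix \<alpha> \<alpha>' x
  assume *: "\<alpha>star < \<alpha>' \<and> \<alpha>' < \<alpha> \<and> x \<in> E_space \<alpha>"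
  then have \<alpha>: "\<alpha>star < \<alpha>'" "\<alpha>' < \<alpha>" and x: "x \<in> E_space \<alpha>" by auto
  define T where "T = (\<alpha> - \<alpha>') / (2 * exp 1 * M \<alpha>)"
  \<comment> \<open>This is where the lifetime is used: \<open>2 e > 4\<close> makes the iteration a contraction.\<close>
  have "2 < exp (1 :: real)" using exp_lower_Taylor_quadratic[of 1] by simp
  then have \<mu>: "4 * M \<alpha> < 2 * exp 1 * M \<alpha>" using M_pos[of \<alpha>] \<alpha> by simp
  have gen: "matrix_op a u = generator u" if "u \<in> E_space \<alpha>'" for u
    using E1(2) \<alpha>(1) that by (intro matrix_op_eq_generator) auto
  obtain u where u: "E_continuous_on \<alpha>' {0..<T} u" "u 0 = x"
    "\<And>\<beta>. \<alpha>star < \<beta> \<Longrightarrow> \<beta> < \<alpha>' \<Longrightarrow> E_continuous_on \<beta> {0..<T} (\<lambda>t. generator (u t))"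
    "\<And>\<beta> t. \<alpha>star < \<beta> \<Longrightarrow> \<beta> < \<alpha>' \<Longrightarrow> t \<in> {0..<T} \<Longrightarrow>
      has_E_derivative \<beta> {0..<T} u (generator (u t)) t"
    using solution_exists[OF \<alpha> x \<mu> T_def] by blast
  have "E_C1_on \<beta> {0..<T} u" if "\<alpha>star < \<beta>" "\<beta> < \<alpha>'" for \<beta>
    unfolding E_C1_on_def using u(3,4)[OF that] by blast
  moreover have "has_E_derivative \<beta> {0..<T} u (matrix_op a (u t)) t"
    if "\<alpha>star < \<beta>" "\<beta> < \<alpha>'" "t \<in> {0..<T}" for \<beta> t
    using u(4)[OF that] gen[of "u t"] u(1) that(3) by (simp add: E_continuous_on_def)
  ultimately have sol: "classical_solution \<alpha>star a \<alpha>' T x u"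
    unfolding classical_solution_def using u(1,2) by auto
  have "v t = u t" if v: "classical_solution \<alpha>star a \<alpha>' T x v" and t: "t \<in> {0..<T}" for v t
  proof (rule solution_unique[OF \<alpha>(1) _ _ u(1,4) _ t])
    show vC: "E_continuous_on \<alpha>' {0..<T} v" and "v 0 = u 0"
      using v u(2) by (auto simp: classical_solution_def)
    show "has_E_derivative \<beta> {0..<T} v (generator (v t)) t"
      if "\<alpha>star < \<beta>" "\<beta> < \<alpha>'" "t \<in> {0..<T}" for \<beta> t
    proof -
      have "has_E_derivative \<beta> {0..<T} v (matrix_op a (v t)) t"
        using v that by (simp add: classical_solution_def)
      then show ?thesis using gen[of "v t"] vC that(3) by (simp add: E_continuous_on_def)
    qed
  qed
  then show "let T = (\<alpha> - \<alpha>') / (2 * exp 1 * M \<alpha>) in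
      \<exists>u. classical_solution \<alpha>star a \<alpha>' T x u \<and>
        (\<forall>v. classical_solution \<alpha>star a \<alpha>' T x v \<longrightarrow> (\<forall>t\<in>{0..<T}. v t = u t))"
    unfolding Let_def T_def[symmetric] using sol by blast
qed

end
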